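(* Let $m,n\ge1$ and $M\in\mathbb Z_4^{m\times n}$. Let $r_4(M)$ be the minimum $k$ for which there exist $u_t\in\{0,1\}^m$, $v_t\in\{0,1\}^n$, $G_t\in\mathbb Z_4$ ($1\le t\le k$) with $M=\sum_{t=1}^k (u_tv_t^\top)\cdot G_t$ modulo $4$. Consider the following two-stage procedure. Stage 1: let $M_1=M\bmod 2$, let $k_1$ be the rank of $M_1$ over $\mathrm{GF}(2)$, and compute any decomposition $M_1=\sum_{t=1}^{k_1}u^{(1)}_t(v^{(1)}_t)^\top$ over $\mathrm{GF}(2)$ with $u_t^{(1)}\in\{0,1\}^m$, $v_t^{(1)}\in\{0,1\}^n$. Stage 2: let $M_2=M-\sum_{t=1}^{k_1}u^{(1)}_t(v^{(1)}_t)^\top \pmod 4$ (with the $0/1$ vectors now regarded as vectors over $\mathbb Z_4$), which has all entries in $\{0,2\}$; let $k_2$ be the rank over $\mathrm{GF}(2)$ of the $0/1$ matrix $\tfrac12M_2$, and compute any decomposition $\tfrac12M_2=\sum_{t=1}^{k_2}u^{(2)}_t(v^{(2)}_t)^\top$ over $\mathrm{GF}(2)$ with $u_t^{(2)}\in\{0,1\}^m$, $v_t^{(2)}\in\{0,1\}^n$. Then this procedure runs in polynomial time, it yields the valid decomposition $$M=\sum_{t=1}^{k_1}u^{(1)}_t(v^{(1)}_t)^\top+\sum_{t=1}^{k_2}2\,u^{(2)}_t(v^{(2)}_t)^\top \pmod 4,$$ and its number of terms satisfies $$k_1+k_2\le 3\,r_4(M).$$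
   Context: For $u\in\{0,1\}^m$, $v\in\{0,1\}^n$ and $G\in\mathbb Z_4$, $(uv^\top)\cdot G$ denotes the $m\times n$ matrix over $\mathbb Z_4$ with $(i,j)$ entry $G$ if $u_iv_j=1$ and $0$ otherwise. For a matrix with entries in $\{0,2\}\subset\mathbb Z_4$, $\tfrac12M_2$ is the $0/1$ matrix obtained by replacing each entry $2$ by $1$. (Here $\mathbb Z_4$ models the cyclic group generated by the phase gate $S=\mathrm{diag}(1,\mathrm i)$.) *)

theory Defs
  imports
    "HOL-Library.Z2"
    "HOL-Library.Numeral_Type"
    "HOL-Computational_Algebra.Polynomial"
    "Jordan_Normal_Form.DL_Rank"
begin

section \<open>Decompositions over \<open>\<int>\<^sub>4\<close> and GF(2)\<close>

text \<open>
  The ring of integers modulo 4 is the numeral type \<open>4\<close>; the field GF(2) is the type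
  \<open>bit\<close>. A 0/1 vector is a \<open>bit vec\<close>; it is regarded as a vector over another
  semiring by means of \<open>map_vec of_bit\<close>.
\<close>

type_synonym z4 = "4"

definition z4_rep :: "z4 \<Rightarrow> nat" where
  "z4_rep x = (LEAST k. of_nat k = x)"

definition mat_mod2 :: "z4 mat \<Rightarrow> bit mat" where
  "mat_mod2 M = map_mat (\<lambda>x. of_nat (z4_rep x)) M"

definition mat_half :: "z4 mat \<Rightarrow> bit mat" where
  "mat_half M = map_mat (\<lambda>x. of_bool (x = 2)) M"

definition mat_sum :: "nat \<Rightarrow> nat \<Rightarrow> nat \<Rightarrow> (nat \<Rightarrow> 'a::comm_monoid_add mat) \<Rightarrow> 'a mat" where
  "mat_sum m n k A = mat m n (\<lambda>(i, j). \<Sum>t<k. A t $$ (i, j))"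

definition outer :: "'a::semiring_0 vec \<Rightarrow> 'a vec \<Rightarrow> 'a mat" where
  "outer u v = mat (dim_vec u) (dim_vec v) (\<lambda>(i, j). u $ i * v $ j)"

abbreviation lift_outer :: "bit vec \<Rightarrow> bit vec \<Rightarrow> z4 mat" where
  "lift_outer u v \<equiv> outer (map_vec of_bit u) (map_vec of_bit v)"

definition gate_outer :: "bit vec \<Rightarrow> bit vec \<Rightarrow> z4 \<Rightarrow> z4 mat" where
  "gate_outer u v G =
     mat (dim_vec u) (dim_vec v) (\<lambda>(i, j). if u $ i * v $ j = 1 then G else 0)"

definition r4 :: "nat \<Rightarrow> nat \<Rightarrow> z4 mat \<Rightarrow> nat" where
  "r4 m n M = (LEAST k. \<exists>u v G.
     (\<forall>t<k. u t \<in> carrier_vec m \<and> v t \<in> carrier_vec n) \<and>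
     M = mat_sum m n k (\<lambda>t. gate_outer (u t) (v t) (G t)))"

definition rank_decomposition ::
  "nat \<Rightarrow> nat \<Rightarrow> bit mat \<Rightarrow> nat \<Rightarrow> (nat \<Rightarrow> bit vec) \<Rightarrow> (nat \<Rightarrow> bit vec) \<Rightarrow> bool" where
  "rank_decomposition m n A k u v \<longleftrightarrow>
     k = vec_space.rank m A \<and>
     (\<forall>t<k. u t \<in> carrier_vec m \<and> v t \<in> carrier_vec n) \<and>
     A = mat_sum m n k (\<lambda>t. outer (u t) (v t))"

definition stage1 ::
  "nat \<Rightarrow> nat \<Rightarrow> z4 mat \<Rightarrow> nat \<Rightarrow> (nat \<Rightarrow> bit vec) \<Rightarrow> (nat \<Rightarrow> bit vec) \<Rightarrow> bool" where
  "stage1 m n M k u v \<longleftrightarrow> rank_decomposition m n (mat_mod2 M) k u v"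

definition residual ::
  "nat \<Rightarrow> nat \<Rightarrow> z4 mat \<Rightarrow> nat \<Rightarrow> (nat \<Rightarrow> bit vec) \<Rightarrow> (nat \<Rightarrow> bit vec) \<Rightarrow> z4 mat" where
  "residual m n M k u v = M - mat_sum m n k (\<lambda>t. lift_outer (u t) (v t))"

definition stage2 ::
  "nat \<Rightarrow> nat \<Rightarrow> z4 mat \<Rightarrow> nat \<Rightarrow> (nat \<Rightarrow> bit vec) \<Rightarrow> (nat \<Rightarrow> bit vec) \<Rightarrow>
   nat \<Rightarrow> (nat \<Rightarrow> bit vec) \<Rightarrow> (nat \<Rightarrow> bit vec) \<Rightarrow> bool" where
  "stage2 m n M k1 u1 v1 k2 u2 v2 \<longleftrightarrow>
     rank_decomposition m n (mat_half (residual m n M k1 u1 v1)) k2 u2 v2"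


section \<open>A machine model with running time\<close>

text \<open>
  A random access machine, programmed in a while language. A state assigns a natural number to
  every scalar variable and to every cell of every two-dimensional array. Each executed command
  and each evaluated test costs one unit. There is no multiplication, so a run of \<open>t\<close> steps of
  a fixed program lengthens the numbers by only \<open>O(t)\<close> bits, and unit cost is polynomially
  related to the running time of a Turing machine.
\<close>

type_synonym vname = string
type_synonym state = "(vname \<Rightarrow> nat) \<times> (vname \<Rightarrow> nat \<Rightarrow> nat \<Rightarrow> nat)"

datatype aexp =
    N nat
  | V vname
  | Cell vname aexp aexp
  | Plus aexp aexp
  | Minus aexp aexp

datatype bexp =
    BLess aexp aexp
  | BNot bexp
  | BAnd bexp bexp

datatype com =
    Skip
  | Assign vname aexp
  | Store vname aexp aexp aexp
  | Seq com com
  | Cond bexp com com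
  | While bexp com

fun aval :: "aexp \<Rightarrow> state \<Rightarrow> nat" where
  "aval (N k) s = k"
| "aval (V x) s = fst s x"
| "aval (Cell a e f) s = snd s a (aval e s) (aval f s)"
| "aval (Plus e f) s = aval e s + aval f s"
| "aval (Minus e f) s = aval e s - aval f s"

fun bval :: "bexp \<Rightarrow> state \<Rightarrow> bool" where
  "bval (BLess e f) s \<longleftrightarrow> aval e s < aval f s"
| "bval (BNot b) s \<longleftrightarrow> \<not> bval b s"
| "bval (BAnd b c) s \<longleftrightarrow> bval b s \<and> bval c s"

definition update_cell :: "state \<Rightarrow> vname \<Rightarrow> nat \<Rightarrow> nat \<Rightarrow> nat \<Rightarrow> state" where
  "update_cell s a i j x = (fst s, (snd s)(a := (snd s a)(i := (snd s a i)(j := x))))"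

text \<open>\<open>exec c s t s'\<close>: started in \<open>s\<close>, the program \<open>c\<close> halts in \<open>s'\<close> after \<open>t\<close> steps.\<close>

inductive exec :: "com \<Rightarrow> state \<Rightarrow> nat \<Rightarrow> state \<Rightarrow> bool" where
  Skip: "exec Skip s 1 s"
| Assign: "exec (Assign x e) s 1 ((fst s)(x := aval e s), snd s)"
| Store: "exec (Store a e f g) s 1 (update_cell s a (aval e s) (aval f s) (aval g s))"
| Seq: "exec c s t s' \<Longrightarrow> exec d s' t' s'' \<Longrightarrow> exec (Seq c d) s (t + t') s''"
| CondTrue: "bval b s \<Longrightarrow> exec c s t s' \<Longrightarrow> exec (Cond b c d) s (Suc t) s'"
| CondFalse: "\<not> bval b s \<Longrightarrow> exec d s t s' \<Longrightarrow> exec (Cond b c d) s (Suc t) s'"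
| WhileFalse: "\<not> bval b s \<Longrightarrow> exec (While b c) s 1 s"
| WhileTrue: "bval b s \<Longrightarrow> exec c s t s' \<Longrightarrow> exec (While b c) s' t' s'' \<Longrightarrow>
    exec (While b c) s (Suc (t + t')) s''"

inductive_cases exec_elims:
  "exec Skip s t s'"
  "exec (Assign x e) s t s'"
  "exec (Store a e f g) s t s'"
  "exec (Seq c d) s t s'"
  "exec (Cond b c d) s t s'"

inductive_cases exec_While: "exec (While b c) s t s'"

lemma exec_deterministic:
  "exec c s t s' \<Longrightarrow> exec c s t' s'' \<Longrightarrow> t' = t \<and> s'' = s'"
proof (induction arbitrary: t' s'' rule: exec.induct)
  case (Skip s)
  from Skip.prems show ?case by (rule exec_elims) simp
next
  case (Assign x e s)
  from Assign.prems show ?case by (rule exec_elims) simp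
next
  case (Store a e f g s)
  from Store.prems show ?case by (rule exec_elims) simp
next
  case (Seq c s t s' d t1 s1)
  from Seq.prems show ?case by (rule exec_elims) (use Seq.IH in blast)
next
  case (CondTrue b s c t s' d)
  from CondTrue.prems show ?case by (rule exec_elims) (use CondTrue.hyps CondTrue.IH in blast)+
next
  case (CondFalse b s d t s' c)
  from CondFalse.prems show ?case by (rule exec_elims) (use CondFalse.hyps CondFalse.IH in blast)+
next
  case (WhileFalse b s c)
  from WhileFalse.prems show ?case by (rule exec_While) (use WhileFalse.hyps in simp)+
next
  case (WhileTrue b s c t s' t1 s1)
  from WhileTrue.prems show ?case by (rule exec_While) (use WhileTrue.hyps WhileTrue.IH in blast)+
qed

text \<open>
  On input, the scalars \<open>m\<close> and \<open>n\<close> hold the dimensions, the array \<open>M\<close> holds the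
  matrix with entries represented in \<open>{0,1,2,3}\<close>, and everything else is 0. On output, row \<open>t\<close>
  of the array \<open>U1\<close> holds the vector with index \<open>t\<close> in the first family of stage 1, and
  similarly for the other families; unused cells are unconstrained.
\<close>

definition input_state :: "nat \<Rightarrow> nat \<Rightarrow> z4 mat \<Rightarrow> state" where
  "input_state m n M =
     ((\<lambda>_. 0)(''m'' := m, ''n'' := n),
      (\<lambda>_ _ _. 0)(''M'' := (\<lambda>i j. if i < m \<and> j < n then z4_rep (M $$ (i, j)) else 0)))"

definition holds_vecs :: "state \<Rightarrow> vname \<Rightarrow> nat \<Rightarrow> nat \<Rightarrow> (nat \<Rightarrow> bit vec) \<Rightarrow> bool" where
  "holds_vecs s a k d u \<longleftrightarrow> (\<forall>t<k. \<forall>i<d. snd s a t i = of_bit (u t $ i))"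

definition holds_output ::
  "state \<Rightarrow> nat \<Rightarrow> nat \<Rightarrow> nat \<Rightarrow> (nat \<Rightarrow> bit vec) \<Rightarrow> (nat \<Rightarrow> bit vec) \<Rightarrow>
   nat \<Rightarrow> (nat \<Rightarrow> bit vec) \<Rightarrow> (nat \<Rightarrow> bit vec) \<Rightarrow> bool" where
  "holds_output s m n k1 u1 v1 k2 u2 v2 \<longleftrightarrow>
     fst s ''k1'' = k1 \<and> holds_vecs s ''U1'' k1 m u1 \<and> holds_vecs s ''V1'' k1 n v1 \<and>
     fst s ''k2'' = k2 \<and> holds_vecs s ''U2'' k2 m u2 \<and> holds_vecs s ''V2'' k2 n v2"

end

theory Submission
  imports Defs
begin

text \<open>
  Rank bound. Let \<open>M = \<Sum>\<^sub>t (u\<^sub>t v\<^sub>t\<^sup>T)\<cdot>G\<^sub>t\<close> have \<open>r\<close> terms, and let \<open>U\<close> be a maximal subset of the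
  \<open>u\<^sub>t\<close> that is independent over GF(2). Lifting to \<open>\<int>\<^sub>4\<close>, each \<open>u\<^sub>t\<close> is a combination of \<open>U\<close> plus a
  defect \<open>2 w\<^sub>t\<close>, where \<open>w\<^sub>t = 0\<close> if \<open>u\<^sub>t \<in> U\<close>. The stage 1 vectors \<open>u1\<^sub>t\<close> lie in the column space of
  \<open>M mod 2\<close>, hence in the span of \<open>U\<close>, and lift in the same way with defects \<open>2 x\<^sub>t\<close>. Since the
  residual vanishes modulo 2 and \<open>U\<close> is independent, its coefficients on \<open>U\<close> are even, so half of the
  residual has its columns in the span of \<open>U\<close>, of the \<open>w\<^sub>t\<close> with \<open>u\<^sub>t \<notin> U\<close>, and of the \<open>x\<^sub>t\<close>. These are at
  most \<open>r + k\<^sub>1\<close> vectors, and \<open>k\<^sub>1 \<le> r\<close>.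

  Algorithm. Both stages peel off rank-one matrices: at a pivot entry \<open>(i, j)\<close> whose bit is 1, subtract
  column \<open>j\<close> times row \<open>i\<close> from the array, which clears the bits of row \<open>i\<close> and column \<open>j\<close>. The peeled
  columns and rows are triangular with respect to the pivots, hence independent, so their number is the
  rank.
\<close>

section \<open>Reduction of \<open>\<int>\<^sub>4\<close> modulo 2\<close>

text \<open>These rules would turn sums of products over GF(2) into cardinalities modulo 2.\<close>

declare add_bit_eq_xor [simp del] mult_bit_eq_and [simp del]

lemma bit_add_self [simp]: "b + b = (0 :: bit)"
  by (cases b) simp_all

lemma bit_add_eq_0_iff: "0 = a + b \<longleftrightarrow> a = (b :: bit)"
  by (cases a; cases b) simp_all

text \<open>Four distinct elements exhaust a type of cardinality 4; most facts about
  \<open>z4\<close> below are then finite case checks.\<close>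

lemma z4_exhaust:
  fixes x :: z4
  shows "x = 0 \<or> x = 1 \<or> x = 2 \<or> x = 3"
proof -
  have "card {0, 1, 2, 3 :: z4} = 4" by simp
  then have "{0, 1, 2, 3 :: z4} = UNIV"
    by (intro card_subset_eq) auto
  then show ?thesis by blast
qed

lemma z4_rep_simps [simp]:
  "z4_rep 0 = 0" "z4_rep 1 = 1" "z4_rep 2 = 2" "z4_rep 3 = 3"
proof -
  have "z4_rep x = k" if "of_nat k = x" "\<forall>j<k. of_nat j \<noteq> x" for x k
    unfolding z4_rep_def by (rule Least_equality) (use that in \<open>auto simp: not_less[symmetric]\<close>)
  from this[of 0 0] this[of 1 1] this[of 2 2] this[of 3 3]
  show "z4_rep 0 = 0" "z4_rep 1 = 1" "z4_rep 2 = 2" "z4_rep 3 = 3"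
    by (simp_all add: numeral_eq_Suc less_Suc_eq)
qed

text \<open>The ring homomorphism onto GF(2), which \<open>mat_mod2\<close> applies
  entrywise.\<close>

definition z4_mod2 :: "z4 \<Rightarrow> bit" where
  "z4_mod2 x = of_nat (z4_rep x)"

lemma z4_mod2_simps [simp]:
  "z4_mod2 0 = 0" "z4_mod2 1 = 1" "z4_mod2 2 = 0" "z4_mod2 3 = 1"
  by (simp_all add: z4_mod2_def)

lemma z4_numerals: "(4::z4) = 0" "(5::z4) = 1" "(6::z4) = 2" "(9::z4) = 1"
  "(- 1::z4) = 3" "(- 2::z4) = 2" "(- 3::z4) = 1"
  by simp_all

lemma z4_mod2_add: "z4_mod2 (x + y) = z4_mod2 x + z4_mod2 y"
  using z4_exhaust[of x] z4_exhaust[of y] by (elim disjE) (simp_all add: z4_numerals)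

lemma z4_mod2_mult: "z4_mod2 (x * y) = z4_mod2 x * z4_mod2 y"
  using z4_exhaust[of x] z4_exhaust[of y] by (elim disjE) (simp_all add: z4_numerals)

lemma z4_mod2_uminus: "z4_mod2 (- x) = z4_mod2 x"
  using z4_exhaust[of x] by (elim disjE) (simp_all add: z4_numerals)

lemma z4_mod2_diff: "z4_mod2 (x - y) = z4_mod2 x + z4_mod2 y"
  by (metis diff_conv_add_uminus z4_mod2_add z4_mod2_uminus)

lemma z4_mod2_sum: "z4_mod2 (\<Sum>t\<in>T. f t) = (\<Sum>t\<in>T. z4_mod2 (f t))"
  by (induction T rule: infinite_finite_induct) (simp_all add: z4_mod2_add)

text \<open>An opaque copy of \<open>of_bit\<close>: the simplifier rewrites sums of \<open>of_bool\<close> into cardinalities.\<close>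

definition bit_z4 :: "bit \<Rightarrow> z4" where
  "bit_z4 b = of_bit b"

lemma bit_z4_simps [simp]: "bit_z4 0 = 0" "bit_z4 1 = 1"
  by (simp_all add: bit_z4_def)

lemma z4_mod2_bit_z4: "z4_mod2 (bit_z4 b) = b"
  by (cases b) simp_all

lemma z4_mod2_eq_0_iff: "z4_mod2 x = 0 \<longleftrightarrow> x \<in> {0, 2}"
  using z4_exhaust[of x] by (elim disjE) simp_all

lemma z4_mod2_eq_0E:
  assumes "z4_mod2 x = 0"
  obtains b where "x = 2 * bit_z4 b"
  using assms that[of 0] that[of 1] by (auto simp: z4_mod2_eq_0_iff)

text \<open>Division by 2 is defined on \<open>{0, 2}\<close> with values modulo 2 only, so halving
  \<open>2 * x\<close> recovers just the parity of \<open>x\<close>.\<close>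

lemma of_bool_double_z4_eq_2: "of_bool (2 * x = (2::z4)) = z4_mod2 x"
  using z4_exhaust[of x] by (elim disjE) simp_all

text \<open>Doubling annihilates \<open>2\<close>, so \<open>2 * x\<close> depends only on the
  parity of \<open>x\<close>. This is why a decomposition over GF(2) is enough in the second
  stage.\<close>

lemma double_bit_z4_z4_mod2: "2 * bit_z4 (z4_mod2 x) = 2 * (x::z4)"
  using z4_exhaust[of x] by (elim disjE) simp_all

lemma double_bit_z4_half: "x \<in> {0, 2} \<Longrightarrow> 2 * bit_z4 (of_bool (x = 2)) = (x::z4)"
  by auto

lemma index_lift_outer:
  "i < dim_vec u \<Longrightarrow> j < dim_vec v \<Longrightarrow> lift_outer u v $$ (i, j) = bit_z4 (u $ i) * bit_z4 (v $ j)"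
  by (simp add: outer_def bit_z4_def)

text \<open>The bracketing isolates the factor from \<open>u\<close>; what remains is a coefficient
  that depends only on the column and the term.\<close>

lemma index_gate_outer:
  "i < dim_vec u \<Longrightarrow> j < dim_vec v \<Longrightarrow> gate_outer u v G $$ (i, j) = bit_z4 (u $ i) * (bit_z4 (v $ j) * G)"
  by (cases "u $ i"; cases "v $ j") (simp_all add: gate_outer_def)

section \<open>Rank and spans\<close>

context vec_space
begin

text \<open>Steinitz exchange: the replacement theorem supplies a set \<open>C\<close> with
  \<open>card C \<le> card B - card A\<close> over the integers, so the difference is not
  negative.\<close>

lemma card_indpt_le_card_span:
  assumes "finite A" "lin_indpt A" "finite B" "B \<subseteq> carrier_vec n" "A \<subseteq> span B"
  shows "card A \<le> card B"
proof -
  obtain C :: "'a vec set" where "int (card C) \<le> int (card B) - int (card A)"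
    using replacement[OF assms(1,3) _ assms(2,5)] assms(4) by simp blast
  then show ?thesis by linarith
qed

lemma maximal_indpt_subset_exists:
  assumes "finite S"
  obtains U where "maximal U (\<lambda>T. T \<subseteq> S \<and> lin_indpt T)" "finite U"
proof -
  have "lin_indpt {}" by (simp add: finite_lin_indpt2)
  then show ?thesis
    using maximal_exists_superset[of S "\<lambda>T. T \<subseteq> S \<and> lin_indpt T" "{}"] assms that by blast
qed

text \<open>A vector of \<open>S\<close> outside \<open>U\<close> makes \<open>U\<close> dependent
  by maximality, and a vector whose addition destroys independence already lies in the span.\<close>

lemma maximal_indpt_subset_spans:
  assumes "maximal U (\<lambda>T. T \<subseteq> S \<and> lin_indpt T)" "S \<subseteq> carrier_vec n"
  shows "S \<subseteq> span U"
proof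
  fix s assume s: "s \<in> S"
  have U: "U \<subseteq> S" "lin_indpt U" and max: "\<And>T. U \<subseteq> T \<Longrightarrow> T \<subseteq> S \<Longrightarrow> lin_indpt T \<Longrightarrow> T = U"
    using assms(1) unfolding maximal_def by blast+
  have Uc: "U \<subseteq> carrier_vec n" using U assms by blast
  show "s \<in> span U"
  proof (cases "s \<in> U")
    case True
    then show ?thesis using in_own_span[OF Uc] by blast
  next
    case False
    then have "lin_dep (U \<union> {s})" using max[of "U \<union> {s}"] U s by blast
    then show ?thesis using lin_dep_iff_in_span[of U s] Uc U s False assms(2) by auto
  qed
qed

lemma rank_le_card_span:
  assumes "A \<in> carrier_mat n nc" "finite S" "S \<subseteq> carrier_vec n" "set (cols A) \<subseteq> span S"
  shows "rank A \<le> card S"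
proof -
  obtain U where U: "maximal U (\<lambda>T. T \<subseteq> set (cols A) \<and> lin_indpt T)" "finite U"
    by (rule maximal_indpt_subset_exists[OF finite_set])
  have "lin_indpt U" "U \<subseteq> span S" using U(1) assms(4) unfolding maximal_def by blast+
  then show ?thesis
    using card_indpt_le_card_span[of U S] rank_card_indpt[OF assms(1) U(1)] U(2) assms by simp
qed

lemma card_indpt_le_rank:
  assumes "A \<in> carrier_mat n nc" "finite W" "lin_indpt W" "W \<subseteq> span (set (cols A))"
  shows "card W \<le> rank A"
proof -
  obtain U where U: "maximal U (\<lambda>T. T \<subseteq> set (cols A) \<and> lin_indpt T)" "finite U"
    by (rule maximal_indpt_subset_exists[OF finite_set])
  have cols: "set (cols A) \<subseteq> carrier_vec n" using assms(1) cols_dim by blast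
  have Uc: "U \<subseteq> carrier_vec n" using U(1) cols unfolding maximal_def by blast
  have "set (cols A) \<subseteq> span U" by (rule maximal_indpt_subset_spans[OF U(1) cols])
  then have "W \<subseteq> span U" using assms(4) span_subsetI[OF Uc] by blast
  then show ?thesis
    using card_indpt_le_card_span[of W U] rank_card_indpt[OF assms(1) U(1)] U(2) Uc assms by simp
qed

text \<open>A generating set no larger than the rank has no room for a vector outside the column
  space: such a vector would extend a basis of that space to an independent set of more than
  \<open>card S\<close> vectors within \<open>span S\<close>.\<close>

lemma generators_in_span_cols:
  assumes "A \<in> carrier_mat n nc" "finite S" "S \<subseteq> carrier_vec n"
    and "set (cols A) \<subseteq> span S" "card S \<le> rank A"
  shows "S \<subseteq> span (set (cols A))"
proof
  fix s assume s: "s \<in> S"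
  obtain U where U: "maximal U (\<lambda>T. T \<subseteq> set (cols A) \<and> lin_indpt T)" "finite U"
    by (rule maximal_indpt_subset_exists[OF finite_set])
  have cols: "set (cols A) \<subseteq> carrier_vec n" using assms(1) cols_dim by blast
  have Uc: "U \<subseteq> carrier_vec n" and UA: "U \<subseteq> set (cols A)" and Ui: "lin_indpt U"
    using U(1) cols unfolding maximal_def by blast+
  have "s \<in> span U"
  proof (rule ccontr)
    assume ns: "s \<notin> span U"
    then have sU: "s \<notin> U" using in_own_span[of U] Uc by auto
    then have "lin_indpt (U \<union> {s})"
      using lin_dep_iff_in_span[of U s] Uc Ui ns s assms(3) by auto
    moreover have "U \<union> {s} \<subseteq> span S" using UA assms(3,4) s in_own_span[of S] by auto
    ultimately have "card (U \<union> {s}) \<le> card S"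
      using card_indpt_le_card_span[of "U \<union> {s}" S] assms(2,3) U(2) by auto
    then show False using rank_card_indpt[OF assms(1) U(1)] sU U(2) assms(5) by simp
  qed
  then show "s \<in> span (set (cols A))" using span_is_monotone[OF UA] by blast
qed

text \<open>Stated coordinatewise and for an indexed family, so that matrix entries fit directly and
  repeated vectors need no care.\<close>

lemma sum_in_span:
  assumes "finite T" "S \<subseteq> carrier_vec n" "\<And>t. t \<in> T \<Longrightarrow> g t \<in> span S"
  shows "vec n (\<lambda>i. \<Sum>t\<in>T. a t * g t $ i) \<in> span S"
  using assms(1,3)
proof (induction T)
  case empty
  have "vec n (\<lambda>i. \<Sum>t\<in>{}. a t * g t $ i) = 0\<^sub>v n" by auto
  then show ?case using submodule.zero_closed[OF span_is_submodule[of S]] assms(2) by simp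
next
  case (insert t T)
  have g: "g t \<in> carrier_vec n" using insert.prems[of t] span_closed[of S] assms(2) by auto
  have "vec n (\<lambda>i. \<Sum>t\<in>insert t T. a t * g t $ i)
      = a t \<cdot>\<^sub>v g t + vec n (\<lambda>i. \<Sum>t\<in>T. a t * g t $ i)"
    using insert.hyps g by auto
  moreover have "a t \<cdot>\<^sub>v g t \<in> span S" using insert.prems[of t] smult_in_span[OF assms(2)] by auto
  moreover have "vec n (\<lambda>i. \<Sum>t\<in>T. a t * g t $ i) \<in> span S" using insert by blast
  ultimately show ?case using span_add1[of S] assms(2) by auto
qed

lemma in_span_imp_sum:
  assumes "finite S" "S \<subseteq> carrier_vec n" "y \<in> span S"
  obtains c where "\<And>i. i < n \<Longrightarrow> y $ i = (\<Sum>x\<in>S. c x * x $ i)"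
proof -
  obtain c where "lincomb c S = y" using finite_in_span[OF assms(1)] assms(2,3) by auto
  then show ?thesis using that lincomb_index[OF _ assms(2)] by metis
qed

lemma lin_indpt_sum_eq_0:
  assumes "finite S" "S \<subseteq> carrier_vec n" "lin_indpt S" "x \<in> S"
    and "\<And>i. i < n \<Longrightarrow> (\<Sum>x\<in>S. c x * x $ i) = 0"
  shows "c x = 0"
proof (rule ccontr)
  assume "c x \<noteq> 0"
  moreover have "lincomb c S = 0\<^sub>v n"
    by (rule eq_vecI) (use assms lincomb_index[OF _ assms(2)] lincomb_dim in auto)
  ultimately have "lin_dep S" using lin_dep_crit[OF assms(1) subset_refl _ assms(4)] by auto
  then show False using assms by blast
qed

end

section \<open>The rank bound\<close>

lemma (in vec_space) cols_subset_span:
  assumes "A \<in> carrier_mat n nc" "\<And>j. j < nc \<Longrightarrow> col A j \<in> span S"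
  shows "set (cols A) \<subseteq> span S"
  using assms by (auto simp: cols_def)

lemma sum_lessThan_add:
  fixes f :: "nat \<Rightarrow> 'a::comm_monoid_add"
  shows "(\<Sum>t<a + b. f t) = (\<Sum>t<a. f t) + (\<Sum>t<b. f (a + t))"
  by (induction b) (simp_all add: add.assoc)

text \<open>The entry formula puts the coefficient \<open>v t $ j\<close> first: column
  \<open>j\<close> of \<open>A\<close> is read as a linear combination of the
  \<open>u t\<close>.\<close>

lemma rank_decompositionD:
  assumes "rank_decomposition m n A k u v"
  shows "k = vec_space.rank m A" "A \<in> carrier_mat m n"
    "\<And>t. t < k \<Longrightarrow> u t \<in> carrier_vec m" "\<And>t. t < k \<Longrightarrow> v t \<in> carrier_vec n"
    "\<And>i j. i < m \<Longrightarrow> j < n \<Longrightarrow> A $$ (i, j) = (\<Sum>t<k. v t $ j * u t $ i)"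
proof -
  from assms have k: "k = vec_space.rank m A"
    and uv: "\<And>t. t < k \<Longrightarrow> u t \<in> carrier_vec m \<and> v t \<in> carrier_vec n"
    and A: "A = mat_sum m n k (\<lambda>t. outer (u t) (v t))"
    unfolding rank_decomposition_def by blast+
  show "k = vec_space.rank m A" by (rule k)
  show "A \<in> carrier_mat m n" by (subst A) (simp add: mat_sum_def)
  show "u t \<in> carrier_vec m" "v t \<in> carrier_vec n" if "t < k" for t using uv[OF that] by auto
  show "A $$ (i, j) = (\<Sum>t<k. v t $ j * u t $ i)" if "i < m" "j < n" for i j
    by (subst A) (use that uv in \<open>auto simp: mat_sum_def outer_def mult.commute
      intro!: sum.cong dest!: uv\<close>)
qed

text \<open>The \<open>k\<close> vectors \<open>u t\<close> span the columns and \<open>k\<close> is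
  the rank, so they cannot leave the column space. In the rank bound this places the stage 1 vectors
  in the span of \<open>U\<close>.\<close>

lemma rank_decomposition_generators_in_span:
  assumes "rank_decomposition m n A k u v" "t < k"
  shows "u t \<in> LinearCombinations.module.span class_ring (module_vec TYPE(bit) m) (set (cols A))"
proof -
  interpret vec_space "TYPE(bit)" m .
  note D = rank_decompositionD[OF assms(1)]
  let ?S = "u ` {..<k}"
  have S: "?S \<subseteq> carrier_vec m" using D by auto
  have "set (cols A) \<subseteq> span ?S"
  proof (rule cols_subset_span[OF D(2)])
    fix j assume j: "j < n"
    have "col A j = vec m (\<lambda>i. \<Sum>t<k. v t $ j * u t $ i)"
      using D(2) D(5) j by auto
    also have "\<dots> \<in> span ?S"
      by (rule sum_in_span[OF _ S]) (use in_own_span[of ?S] S in auto)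
    finally show "col A j \<in> span ?S" .
  qed
  moreover have "card ?S \<le> rank A" using card_image_le[of "{..<k}" u] D(1) by simp
  ultimately show ?thesis using generators_in_span_cols[OF D(2) _ S] assms(2) by blast
qed

text \<open>The identity expressing \<open>y\<close> over GF(2) holds modulo 2 after lifting, so the
  lifted difference is even in every coordinate; \<open>w\<close> records its halves.\<close>

lemma lift_of_span:
  assumes "finite U" "U \<subseteq> carrier_vec m"
    and "y \<in> LinearCombinations.module.span class_ring (module_vec TYPE(bit) m) U"
  obtains c w where "w \<in> carrier_vec m"
    "\<And>i. i < m \<Longrightarrow> bit_z4 (y $ i) = (\<Sum>x\<in>U. bit_z4 (c x) * bit_z4 (x $ i)) + 2 * bit_z4 (w $ i)"
proof -
  interpret vec_space "TYPE(bit)" m .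
  obtain c where c: "\<And>i. i < m \<Longrightarrow> y $ i = (\<Sum>x\<in>U. c x * x $ i)"
    using in_span_imp_sum[OF assms] by blast
  let ?d = "\<lambda>i. bit_z4 (y $ i) - (\<Sum>x\<in>U. bit_z4 (c x) * bit_z4 (x $ i))"
  have "\<exists>b. ?d i = 2 * bit_z4 b" if "i < m" for i
  proof -
    have "z4_mod2 (?d i) = 0"
      using c[OF that] by (simp only: z4_mod2_diff z4_mod2_sum z4_mod2_mult z4_mod2_bit_z4) simp
    then show ?thesis by (rule z4_mod2_eq_0E) blast
  qed
  then obtain b where b: "\<And>i. i < m \<Longrightarrow> ?d i = 2 * bit_z4 (b i)" by metis
  show thesis
    by (rule that[of "vec m b" c]) (use b in \<open>auto simp: algebra_simps\<close>)
qed

section \<open>Validity of the two-stage decomposition and the bounds on its ranks\<close>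

context
  fixes m n :: nat and M :: "z4 mat" and k1 :: nat and u1 v1 :: "nat \<Rightarrow> bit vec"
  assumes M: "M \<in> carrier_mat m n" and stage1: "stage1 m n M k1 u1 v1"
begin

private lemmas D1 = rank_decompositionD[OF stage1[unfolded stage1_def]]

lemma mat_mod2_index: "i < m \<Longrightarrow> j < n \<Longrightarrow> mat_mod2 M $$ (i, j) = z4_mod2 (M $$ (i, j))"
  using M by (simp add: mat_mod2_def z4_mod2_def)

lemma residual_carrier: "residual m n M k1 u1 v1 \<in> carrier_mat m n"
  using M by (intro carrier_matI) (simp_all add: residual_def mat_sum_def)

lemma residual_index:
  assumes "i < m" "j < n"
  shows "residual m n M k1 u1 v1 $$ (i, j)
    = M $$ (i, j) - (\<Sum>t<k1. bit_z4 (u1 t $ i) * bit_z4 (v1 t $ j))"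
  using assms M D1(3,4)[THEN carrier_vecD] by (simp add: residual_def mat_sum_def index_lift_outer[simplified])

lemma residual_mod2:
  assumes "i < m" "j < n"
  shows "z4_mod2 (residual m n M k1 u1 v1 $$ (i, j)) = 0"
  using D1(5)[OF assms] mat_mod2_index[OF assms]
  by (simp only: residual_index[OF assms] z4_mod2_diff z4_mod2_sum z4_mod2_mult z4_mod2_bit_z4)
    (simp add: mult.commute)

context
  fixes k2 :: nat and u2 v2 :: "nat \<Rightarrow> bit vec"
  assumes stage2: "stage2 m n M k1 u1 v1 k2 u2 v2"
begin

private lemmas D2 = rank_decompositionD[OF stage2[unfolded stage2_def]]

lemma mat_half_residual_index:
  "i < m \<Longrightarrow> j < n \<Longrightarrow> mat_half (residual m n M k1 u1 v1) $$ (i, j)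
    = of_bool (residual m n M k1 u1 v1 $$ (i, j) = 2)"
  using residual_carrier by (simp add: mat_half_def)

text \<open>The residual entries are even, and doubling sees only the parity of the stage 2 sum, so
  it does not matter whether that sum is taken over GF(2) or modulo 4.\<close>

lemma two_stage_index:
  assumes "i < m" "j < n"
  shows "M $$ (i, j) = (\<Sum>t<k1. bit_z4 (u1 t $ i) * bit_z4 (v1 t $ j))
    + (\<Sum>t<k2. 2 * (bit_z4 (u2 t $ i) * bit_z4 (v2 t $ j)))"
proof -
  let ?R = "residual m n M k1 u1 v1 $$ (i, j)"
  let ?s = "\<Sum>t<k2. bit_z4 (u2 t $ i) * bit_z4 (v2 t $ j)"
  have "?R \<in> {0, 2}" using residual_mod2[OF assms] z4_mod2_eq_0_iff by blast
  then have "?R = 2 * bit_z4 (of_bool (?R = 2))" by (rule double_bit_z4_half[symmetric])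
  also have "of_bool (?R = 2) = z4_mod2 ?s"
    using D2(5)[OF assms] mat_half_residual_index[OF assms]
    by (simp only: z4_mod2_sum z4_mod2_mult z4_mod2_bit_z4) (simp add: mult.commute)
  also have "2 * bit_z4 (z4_mod2 ?s) = 2 * ?s" by (rule double_bit_z4_z4_mod2)
  finally show ?thesis
    unfolding residual_index[OF assms] by (simp add: sum_distrib_left algebra_simps)
qed

lemma two_stage_decomposition:
  "M = mat_sum m n k1 (\<lambda>t. lift_outer (u1 t) (v1 t)) +
       mat_sum m n k2 (\<lambda>t. 2 \<cdot>\<^sub>m lift_outer (u2 t) (v2 t))"
proof (rule eq_matI)
  fix i j
  let ?N = "mat_sum m n k1 (\<lambda>t. lift_outer (u1 t) (v1 t)) +
       mat_sum m n k2 (\<lambda>t. 2 \<cdot>\<^sub>m lift_outer (u2 t) (v2 t))"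
  assume "i < dim_row ?N" "j < dim_col ?N"
  then have ij: "i < m" "j < n" by (auto simp: mat_sum_def)
  have "dim_row (lift_outer u v) = dim_vec u" "dim_col (lift_outer u v) = dim_vec v" for u v
    by (auto simp: outer_def)
  then show "M $$ (i, j) = ?N $$ (i, j)"
    using two_stage_index[OF ij] ij D1(3,4)[THEN carrier_vecD] D2(3,4)[THEN carrier_vecD]
    by (simp add: mat_sum_def index_lift_outer[simplified])
qed (use M in \<open>auto simp: mat_sum_def\<close>)

text \<open>Gates \<open>1\<close> and \<open>2\<close> for the two stages give one decomposition of
  the kind minimised by \<open>r4\<close>, so that the minimum is attained.\<close>

lemma two_stage_gates:
  "\<exists>u v G. (\<forall>t<k1 + k2. u t \<in> carrier_vec m \<and> v t \<in> carrier_vec n) \<and>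
     M = mat_sum m n (k1 + k2) (\<lambda>t. gate_outer (u t) (v t) (G t))"
proof (intro exI conjI)
  let ?u = "\<lambda>t. if t < k1 then u1 t else u2 (t - k1)"
  let ?v = "\<lambda>t. if t < k1 then v1 t else v2 (t - k1)"
  let ?G = "\<lambda>t. if t < k1 then 1 else 2 :: z4"
  show uv: "\<forall>t<k1 + k2. ?u t \<in> carrier_vec m \<and> ?v t \<in> carrier_vec n"
    using D1(3,4) D2(3,4) by auto
  show "M = mat_sum m n (k1 + k2) (\<lambda>t. gate_outer (?u t) (?v t) (?G t))"
  proof (rule eq_matI)
    fix i j
    assume "i < dim_row (mat_sum m n (k1 + k2) (\<lambda>t. gate_outer (?u t) (?v t) (?G t)))"
      "j < dim_col (mat_sum m n (k1 + k2) (\<lambda>t. gate_outer (?u t) (?v t) (?G t)))"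
    then have ij: "i < m" "j < n" by (auto simp: mat_sum_def)
    have "(\<Sum>t<k1 + k2. gate_outer (?u t) (?v t) (?G t) $$ (i, j))
        = (\<Sum>t<k1 + k2. bit_z4 (?u t $ i) * (bit_z4 (?v t $ j) * ?G t))"
    proof (rule sum.cong[OF refl])
      fix t assume "t \<in> {..<k1 + k2}"
      then have "dim_vec (?u t) = m" "dim_vec (?v t) = n" using uv by auto
      then show "gate_outer (?u t) (?v t) (?G t) $$ (i, j)
          = bit_z4 (?u t $ i) * (bit_z4 (?v t $ j) * ?G t)"
        using ij by (simp only: index_gate_outer)
    qed
    also have "\<dots> = M $$ (i, j)"
      unfolding two_stage_index[OF ij]
      by (simp add: sum_lessThan_add mult.commute mult.left_commute)
    finally show "M $$ (i, j) = mat_sum m n (k1 + k2) (\<lambda>t. gate_outer (?u t) (?v t) (?G t)) $$ (i, j)"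
      using ij by (simp add: mat_sum_def)
  qed (use M in \<open>auto simp: mat_sum_def\<close>)
qed

text \<open>For every decomposition with \<open>r\<close> terms the bounds combine to
  \<open>k1 + k2 \<le> r + 2 * k1 \<le> 3 * r\<close>.\<close>

lemma two_stage_ranks_le:
  assumes uv: "\<And>t. t < r \<Longrightarrow> u t \<in> carrier_vec m \<and> v t \<in> carrier_vec n"
    and Mr: "M = mat_sum m n r (\<lambda>t. gate_outer (u t) (v t) (G t))"
  shows "k1 \<le> r" "k2 \<le> r + k1"
proof -
  interpret vec_space "TYPE(bit)" m .
  \<comment> \<open>Column \<open>j\<close> of \<open>M\<close> is the combination of the lifted
    \<open>u t\<close> with coefficients \<open>g j t\<close>; \<open>h\<close> has the same role
    for the stage 1 sum.\<close>
  define g where "g j t = bit_z4 (v t $ j) * G t" for j t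
  define h where "h j t = bit_z4 (v1 t $ j)" for j t
  have Mij: "M $$ (i, j) = (\<Sum>t<r. bit_z4 (u t $ i) * g j t)" if "i < m" "j < n" for i j
  proof -
    have "gate_outer (u t) (v t) (G t) $$ (i, j) = bit_z4 (u t $ i) * g j t" if "t < r" for t
      unfolding g_def using uv[OF that] \<open>i < m\<close> \<open>j < n\<close> by (intro index_gate_outer) auto
    then show ?thesis by (subst Mr) (use that in \<open>simp add: mat_sum_def\<close>)
  qed
  let ?S = "u ` {..<r}"
  have S: "?S \<subseteq> carrier_vec m" using uv by auto
  have cols1: "set (cols (mat_mod2 M)) \<subseteq> span ?S"
  proof (rule cols_subset_span[OF D1(2)])
    fix j assume j: "j < n"
    have "col (mat_mod2 M) j = vec m (\<lambda>i. \<Sum>t<r. z4_mod2 (g j t) * u t $ i)"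
      using D1(2) mat_mod2_index[of _ j] j
      by (intro eq_vecI) (simp_all add: Mij z4_mod2_sum z4_mod2_mult z4_mod2_bit_z4 mult.commute)
    also have "\<dots> \<in> span ?S"
      by (rule sum_in_span[OF _ S]) (use in_own_span[of ?S] S in auto)
    finally show "col (mat_mod2 M) j \<in> span ?S" .
  qed
  have "card ?S \<le> r" using card_image_le[of "{..<r}" u] by simp
  then show "k1 \<le> r" using rank_le_card_span[OF D1(2) _ S cols1] D1(1) by simp

  obtain U where Umax: "maximal U (\<lambda>T. T \<subseteq> ?S \<and> lin_indpt T)" and finU: "finite U"
    by (rule maximal_indpt_subset_exists[of ?S]) auto
  have US: "U \<subseteq> ?S" and Ui: "lin_indpt U" using Umax unfolding maximal_def by blast+
  have U: "U \<subseteq> carrier_vec m" using US S by blast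
  have SU: "?S \<subseteq> span U" by (rule maximal_indpt_subset_spans[OF Umax S])
  have u1U: "u1 t \<in> span U" if "t < k1" for t
  proof -
    have "set (cols (mat_mod2 M)) \<subseteq> span U" using cols1 span_subsetI[OF U SU] by blast
    then have "span (set (cols (mat_mod2 M))) \<subseteq> span U" by (rule span_subsetI[OF U])
    then show ?thesis
      using rank_decomposition_generators_in_span[OF stage1[unfolded stage1_def] that] by blast
  qed

  \<comment> \<open>The coefficients \<open>c\<close> reproduce \<open>y\<close> modulo 2, and
    \<open>w\<close> is the defect caused by carries.\<close>
  define lifts where "lifts y c w \<longleftrightarrow> w \<in> carrier_vec m \<and>
      (\<forall>i<m. bit_z4 (y $ i) = (\<Sum>x\<in>U. bit_z4 (c x) * bit_z4 (x $ i)) + 2 * bit_z4 (w $ i))"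
    for y :: "bit vec" and c w
  have lifts_ex: "\<exists>c w. lifts y c w" if "y \<in> span U" for y
    by (rule lift_of_span[OF finU U that]) (auto simp: lifts_def)
  have "\<exists>c w. lifts (u t) c w \<and> (u t \<in> U \<longrightarrow> w = 0\<^sub>v m)" if "t < r" for t
  proof (cases "u t \<in> U")
    case True
    \<comment> \<open>The indicator of \<open>u t\<close> reproduces it exactly, so vectors already
      in \<open>U\<close> need no defect vector; this keeps the count below at
      \<open>r + k1\<close>.\<close>
    have "bit_z4 (u t $ i) = (\<Sum>x\<in>U. bit_z4 (of_bool (x = u t)) * bit_z4 (x $ i))" for i
    proof -
      have "(\<Sum>x\<in>U. bit_z4 (of_bool (x = u t)) * bit_z4 (x $ i))
          = (\<Sum>x\<in>U. if x = u t then bit_z4 (u t $ i) else 0)"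
        by (rule sum.cong) auto
      then show ?thesis using True finU by simp
    qed
    then have "lifts (u t) (\<lambda>x. of_bool (x = u t)) (0\<^sub>v m)" unfolding lifts_def by simp
    then show ?thesis by blast
  next
    case False
    have "u t \<in> span U" using SU that by blast
    then show ?thesis using lifts_ex False by blast
  qed
  then obtain c w where cw: "\<And>t. t < r \<Longrightarrow> lifts (u t) (c t) (w t)"
      and w0: "\<And>t. t < r \<Longrightarrow> u t \<in> U \<Longrightarrow> w t = 0\<^sub>v m"
    by metis
  have w: "w t \<in> carrier_vec m" if "t < r" for t using cw[OF that] by (simp add: lifts_def)
  have uc: "bit_z4 (u t $ i) = (\<Sum>x\<in>U. bit_z4 (c t x) * bit_z4 (x $ i)) + 2 * bit_z4 (w t $ i)"
    if "t < r" "i < m" for t i using cw[OF that(1)] that(2) by (simp add: lifts_def)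
  obtain a x where ax: "\<And>t. t < k1 \<Longrightarrow> lifts (u1 t) (a t) (x t)" using lifts_ex[OF u1U] by metis
  have x: "x t \<in> carrier_vec m" if "t < k1" for t using ax[OF that] by (simp add: lifts_def)
  have u1a: "bit_z4 (u1 t $ i) = (\<Sum>y\<in>U. bit_z4 (a t y) * bit_z4 (y $ i)) + 2 * bit_z4 (x t $ i)"
    if "t < k1" "i < m" for t i using ax[OF that(1)] that(2) by (simp add: lifts_def)

  let ?R = "residual m n M k1 u1 v1"
  \<comment> \<open>Substituting the lifts splits the residual: \<open>z j y\<close> is the
    coefficient of \<open>y \<in> U\<close> in column \<open>j\<close>, and \<open>2 * e i j\<close>
    is the total defect.\<close>
  define z where "z j y = (\<Sum>t<r. bit_z4 (c t y) * g j t) - (\<Sum>t<k1. bit_z4 (a t y) * h j t)" for j y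
  define e where "e i j = (\<Sum>t<r. bit_z4 (w t $ i) * g j t) - (\<Sum>t<k1. bit_z4 (x t $ i) * h j t)" for i j
  have R: "?R $$ (i, j) = (\<Sum>y\<in>U. bit_z4 (y $ i) * z j y) + 2 * e i j" if "i < m" "j < n" for i j
  proof -
    have "(\<Sum>t<r. bit_z4 (u t $ i) * g j t)
        = (\<Sum>t<r. (\<Sum>y\<in>U. bit_z4 (c t y) * bit_z4 (y $ i)) * g j t) + 2 * (\<Sum>t<r. bit_z4 (w t $ i) * g j t)"
    proof -
      have "(\<Sum>t<r. bit_z4 (u t $ i) * g j t) = (\<Sum>t<r. (\<Sum>y\<in>U. bit_z4 (c t y) * bit_z4 (y $ i)) * g j t
          + 2 * (bit_z4 (w t $ i) * g j t))"
        by (rule sum.cong) (simp_all only: lessThan_iff uc that distrib_right mult.assoc)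
      then show ?thesis by (simp only: sum.distrib sum_distrib_left)
    qed
    also have "(\<Sum>t<r. (\<Sum>y\<in>U. bit_z4 (c t y) * bit_z4 (y $ i)) * g j t)
        = (\<Sum>y\<in>U. bit_z4 (y $ i) * (\<Sum>t<r. bit_z4 (c t y) * g j t))"
      unfolding sum_distrib_left sum_distrib_right by (subst sum.swap) (simp add: mult_ac)
    finally have 1: "(\<Sum>t<r. bit_z4 (u t $ i) * g j t) = (\<Sum>y\<in>U. bit_z4 (y $ i) * (\<Sum>t<r. bit_z4 (c t y) * g j t))
        + 2 * (\<Sum>t<r. bit_z4 (w t $ i) * g j t)" .
    have "(\<Sum>t<k1. bit_z4 (u1 t $ i) * h j t)
        = (\<Sum>t<k1. (\<Sum>y\<in>U. bit_z4 (a t y) * bit_z4 (y $ i)) * h j t) + 2 * (\<Sum>t<k1. bit_z4 (x t $ i) * h j t)"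
    proof -
      have "(\<Sum>t<k1. bit_z4 (u1 t $ i) * h j t) = (\<Sum>t<k1. (\<Sum>y\<in>U. bit_z4 (a t y) * bit_z4 (y $ i)) * h j t
          + 2 * (bit_z4 (x t $ i) * h j t))"
        by (rule sum.cong) (simp_all only: lessThan_iff u1a that distrib_right mult.assoc)
      then show ?thesis by (simp only: sum.distrib sum_distrib_left)
    qed
    also have "(\<Sum>t<k1. (\<Sum>y\<in>U. bit_z4 (a t y) * bit_z4 (y $ i)) * h j t)
        = (\<Sum>y\<in>U. bit_z4 (y $ i) * (\<Sum>t<k1. bit_z4 (a t y) * h j t))"
      unfolding sum_distrib_left sum_distrib_right by (subst sum.swap) (simp add: mult_ac)
    finally have 2: "(\<Sum>t<k1. bit_z4 (u1 t $ i) * h j t) = (\<Sum>y\<in>U. bit_z4 (y $ i) * (\<Sum>t<k1. bit_z4 (a t y) * h j t))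
        + 2 * (\<Sum>t<k1. bit_z4 (x t $ i) * h j t)" .
    have "?R $$ (i, j) = (\<Sum>t<r. bit_z4 (u t $ i) * g j t) - (\<Sum>t<k1. bit_z4 (u1 t $ i) * h j t)"
      unfolding residual_index[OF that] Mij[OF that] h_def ..
    then show ?thesis
      unfolding 1 2 z_def e_def by (simp add: right_diff_distrib sum_subtractf)
  qed
  \<comment> \<open>Modulo 2 the defect disappears and the residual is zero, leaving a vanishing
    combination of the independent set \<open>U\<close>.\<close>
  have "z4_mod2 (z j y) = 0" if "j < n" "y \<in> U" for j y
  proof (rule lin_indpt_sum_eq_0[OF finU U Ui that(2)])
    fix i assume "i < m"
    then show "(\<Sum>y\<in>U. z4_mod2 (z j y) * y $ i) = 0"
      using residual_mod2[of i j] that(1)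
      by (simp add: R z4_mod2_add z4_mod2_mult z4_mod2_sum z4_mod2_bit_z4 mult.commute)
  qed
  then have "\<exists>b. z j y = 2 * bit_z4 b" if "j < n" "y \<in> U" for j y
    using that z4_mod2_eq_0E by metis
  then obtain b where b: "\<And>j y. j < n \<Longrightarrow> y \<in> U \<Longrightarrow> z j y = 2 * bit_z4 (b j y)" by metis
  \<comment> \<open>Both parts are now even, so the factor 2 comes out and halving amounts to
    reducing the cofactor modulo 2; signs vanish over GF(2).\<close>
  have half: "mat_half ?R $$ (i, j) = (\<Sum>y\<in>U. b j y * y $ i)
      + ((\<Sum>t<r. z4_mod2 (g j t) * w t $ i) + (\<Sum>t<k1. z4_mod2 (h j t) * x t $ i))" if "i < m" "j < n" for i j
  proof -
    have "?R $$ (i, j) = 2 * ((\<Sum>y\<in>U. bit_z4 (y $ i) * bit_z4 (b j y)) + e i j)"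
    proof -
      have "(\<Sum>y\<in>U. bit_z4 (y $ i) * z j y) = (\<Sum>y\<in>U. 2 * (bit_z4 (y $ i) * bit_z4 (b j y)))"
        by (rule sum.cong) (simp_all only: b that mult.left_commute)
      then show ?thesis unfolding R[OF that] by (simp only: sum_distrib_left distrib_left)
    qed
    then have "mat_half ?R $$ (i, j) = z4_mod2 ((\<Sum>y\<in>U. bit_z4 (y $ i) * bit_z4 (b j y)) + e i j)"
      unfolding mat_half_residual_index[OF that] by (simp only: of_bool_double_z4_eq_2)
    then show ?thesis
      by (simp only: e_def z4_mod2_add z4_mod2_diff z4_mod2_sum z4_mod2_mult z4_mod2_bit_z4)
        (simp add: mult.commute)
  qed
  let ?I = "{t. t < r \<and> u t \<in> U}" and ?J = "{t. t < r \<and> u t \<notin> U}"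
  \<comment> \<open>Defects are collected only for \<open>u t \<notin> U\<close>; the others are
    zero.\<close>
  let ?W = "U \<union> (w ` ?J \<union> x ` {..<k1})"
  have W: "?W \<subseteq> carrier_vec m" and finW: "finite ?W" using U w x finU by auto
  have inW: "y \<in> span ?W" if "y \<in> ?W" for y using in_own_span[of ?W] W that by auto
  have wW: "w t \<in> span ?W" if "t < r" for t
  proof (cases "u t \<in> U")
    case True
    then show ?thesis using w0[OF that] submodule.zero_closed[OF span_is_submodule[of ?W]] W by simp
  next
    case False
    then show ?thesis using inW that by blast
  qed
  have "set (cols (mat_half ?R)) \<subseteq> span ?W"
  proof (rule cols_subset_span[OF D2(2)])
    fix j assume j: "j < n"
    let ?p = "vec m (\<lambda>i. \<Sum>y\<in>U. b j y * y $ i)"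
    let ?q = "vec m (\<lambda>i. \<Sum>t<r. z4_mod2 (g j t) * w t $ i)"
    let ?s = "vec m (\<lambda>i. \<Sum>t<k1. z4_mod2 (h j t) * x t $ i)"
    have "?p \<in> span ?W" "?q \<in> span ?W" "?s \<in> span ?W"
      by (rule sum_in_span[OF _ W]; use finU inW wW in blast)+
    then have "?p + (?q + ?s) \<in> span ?W" using span_add1[of ?W] W by auto
    moreover have "col (mat_half ?R) j = ?p + (?q + ?s)"
      using D2(2) j by (intro eq_vecI) (auto simp: half)
    ultimately show "col (mat_half ?R) j \<in> span ?W" by simp
  qed
  then have "k2 \<le> card ?W" using rank_le_card_span[OF D2(2) finW W] D2(1) by simp
  also have "\<dots> \<le> card U + (card (w ` ?J) + card (x ` {..<k1}))"
    using card_Un_le[of U "w ` ?J \<union> x ` {..<k1}"] card_Un_le[of "w ` ?J" "x ` {..<k1}"] by linarith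
  also have "\<dots> \<le> card ?I + (card ?J + k1)"
  proof -
    \<comment> \<open>The \<open>u t\<close> may repeat, but each member of \<open>U\<close> is hit
      by some index in \<open>?I\<close>. Together with \<open>?J\<close> these indices make up
      exactly the \<open>r\<close> terms.\<close>
    have "U \<subseteq> u ` ?I" using US by auto
    then have "card U \<le> card ?I" by (rule surj_card_le[rotated]) simp
    moreover have "card (w ` ?J) \<le> card ?J" by (rule card_image_le) simp
    moreover have "card (x ` {..<k1}) \<le> k1" using card_image_le[of "{..<k1}" x] by simp
    ultimately show ?thesis by linarith
  qed
  also have "card ?I + (card ?J + k1) = card (?I \<union> ?J) + k1"
    by (subst card_Un_disjoint) auto
  also have "?I \<union> ?J = {..<r}" by auto
  finally show "k2 \<le> r + k1" by simp
qed

lemma two_stage_ranks_le_r4: "k1 + k2 \<le> 3 * r4 m n M"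
proof -
  have "\<exists>u v G. (\<forall>t<r4 m n M. u t \<in> carrier_vec m \<and> v t \<in> carrier_vec n) \<and>
     M = mat_sum m n (r4 m n M) (\<lambda>t. gate_outer (u t) (v t) (G t))"
    unfolding r4_def
    by (rule LeastI[where P = "\<lambda>k. \<exists>u v G. (\<forall>t<k. u t \<in> carrier_vec m \<and> v t \<in> carrier_vec n) \<and>
      M = mat_sum m n k (\<lambda>t. gate_outer (u t) (v t) (G t))", OF two_stage_gates])
  then obtain u v G where "\<And>t. t < r4 m n M \<Longrightarrow> u t \<in> carrier_vec m \<and> v t \<in> carrier_vec n"
    "M = mat_sum m n (r4 m n M) (\<lambda>t. gate_outer (u t) (v t) (G t))" by blast
  from two_stage_ranks_le[OF this] show ?thesis by linarith
qed

end

end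

section \<open>Rank-one peeling\<close>

text \<open>Each term has a pivot \<open>(p t, q t)\<close> at which its own vectors are 1 and all
  later ones 0. Forward substitution along \<open>p\<close> makes the \<open>u t\<close>
  independent, along \<open>q\<close> it recovers each \<open>u t\<close> from columns of
  \<open>A\<close>; hence the rank is at least \<open>k\<close>, and having \<open>k\<close> terms
  gives the converse.\<close>

lemma triangular_rank_decomposition:
  assumes A: "A \<in> carrier_mat m n"
    and uv: "\<And>t. t < k \<Longrightarrow> u t \<in> carrier_vec m" "\<And>t. t < k \<Longrightarrow> v t \<in> carrier_vec n"
    and Aij: "\<And>i j. i < m \<Longrightarrow> j < n \<Longrightarrow> A $$ (i, j) = (\<Sum>t<k. v t $ j * u t $ i)"
    and p: "\<And>t. t < k \<Longrightarrow> p t < m" "\<And>t. t < k \<Longrightarrow> u t $ p t = 1"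
      "\<And>s t. s < t \<Longrightarrow> t < k \<Longrightarrow> u t $ p s = 0"
    and q: "\<And>t. t < k \<Longrightarrow> q t < n" "\<And>t. t < k \<Longrightarrow> v t $ q t = 1"
      "\<And>s t. s < t \<Longrightarrow> t < k \<Longrightarrow> v t $ q s = 0"
  shows "rank_decomposition m n A k u v"
proof -
  interpret vec_space "TYPE(bit)" m .
  let ?S = "u ` {..<k}" and ?C = "set (cols A)"
  have S: "?S \<subseteq> carrier_vec m" using uv by auto
  have C: "?C \<subseteq> carrier_vec m" using A cols_dim by blast
  have colA: "col A j = vec m (\<lambda>i. \<Sum>t<k. v t $ j * u t $ i)" if "j < n" for j
    using A Aij that by auto
  have "?C \<subseteq> span ?S"
  proof (rule cols_subset_span[OF A])
    fix j assume "j < n"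
    then show "col A j \<in> span ?S"
      by (subst colA) (use in_own_span[of ?S] S in \<open>auto intro!: sum_in_span[OF _ S]\<close>)
  qed
  then have "rank A \<le> card ?S" by (intro rank_le_card_span[OF A _ S]) auto
  also have "card ?S \<le> k" using card_image_le[of "{..<k}" u] by simp
  finally have "rank A \<le> k" .
  have u_span: "u t \<in> span ?C" if "t < k" for t
    using that
  proof (induction t rule: less_induct)
    case (less t)
    \<comment> \<open>Column \<open>q t\<close> involves only the terms up to \<open>t\<close>;
      adding \<open>?rest\<close>, the contribution of the earlier ones, cancels it over GF(2) and
      leaves \<open>u t\<close>.\<close>
    let ?rest = "vec m (\<lambda>i. \<Sum>s<t. v s $ q t * u s $ i)"
    have "?rest \<in> span ?C"
      by (intro sum_in_span[OF _ C]) (use less in auto)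
    moreover have "col A (q t) \<in> span ?C"
      using in_own_span[of ?C] C A q(1)[OF less.prems] by (auto simp: cols_def)
    ultimately have "col A (q t) + ?rest \<in> span ?C" using span_add1[of ?C] C by auto
    moreover have "col A (q t) + ?rest = u t"
    proof (rule eq_vecI)
      fix i assume "i < dim_vec (u t)"
      then have i: "i < m" using uv(1)[OF less.prems] by simp
      have "(\<Sum>s<k. v s $ q t * u s $ i) = (\<Sum>s<Suc t. v s $ q t * u s $ i)"
        using less.prems q(3) by (intro sum.mono_neutral_right) (auto simp: not_less Suc_le_eq)
      then show "(col A (q t) + ?rest) $ i = u t $ i"
        using i q(1,2)[OF less.prems] by (simp add: colA add.left_commute[of _ "u t $ i"])
    qed (use uv(1)[OF less.prems] in auto)
    ultimately show ?case by simp
  qed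
  have inj: "inj_on u {..<k}"
  proof (rule linorder_inj_onI)
    fix s t assume "s < t" "s \<in> {..<k}" "t \<in> {..<k}"
    then show "u s \<noteq> u t" using p(2)[of s] p(3)[of s t] by fastforce
  qed auto
  have "lin_indpt ?S"
  proof (rule finite_lin_indpt2)
    fix c assume c0: "lincomb c ?S = 0\<^sub>v m"
    have "c (u t) = 0" if "t < k" for t
      using that
    proof (induction t rule: less_induct)
      case (less t)
      have "0 = lincomb c ?S $ p t" using c0 p(1)[OF less.prems] by simp
      also have "\<dots> = (\<Sum>s<k. c (u s) * u s $ p t)"
        using lincomb_index[OF p(1)[OF less.prems] S] sum.reindex[OF inj] by simp
      \<comment> \<open>At coordinate \<open>p t\<close> the later vectors vanish, and the earlier
        coefficients are zero by induction.\<close>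
      also have "\<dots> = (\<Sum>s\<in>{t}. c (u s) * u s $ p t)"
      proof (rule sum.mono_neutral_right)
        show "\<forall>s\<in>{..<k} - {t}. c (u s) * u s $ p t = 0"
          using less p(3) by (metis Diff_iff insertCI lessThan_iff linorder_neqE_nat mult_zero_left mult_zero_right)
      qed (use less.prems in auto)
      finally show ?case using p(2)[OF less.prems] by simp
    qed
    then show "\<forall>x\<in>?S. c x = 0" by auto
  qed (use S in auto)
  then have "card ?S \<le> rank A"
    using u_span by (intro card_indpt_le_rank[OF A]) auto
  then have "k \<le> rank A" using card_image[OF inj] by simp
  moreover have "A = mat_sum m n k (\<lambda>t. outer (u t) (v t))"
    using A Aij uv[THEN carrier_vecD] by (intro eq_matI) (auto simp: mat_sum_def outer_def mult.commute)
  ultimately show ?thesis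
    using \<open>rank A \<le> k\<close> uv unfolding rank_decomposition_def by simp
qed

section \<open>The peeling invariant\<close>

type_synonym array = "nat \<Rightarrow> nat \<Rightarrow> nat"

text \<open>One abstraction for both stages: \<open>d\<close> is the gate being peeled off, 1 or 2,
  \<open>bit_f\<close> is the bit of an entry that the stage has to clear, and \<open>step_f\<close>
  subtracts \<open>d\<close> modulo 4, which flips that bit.\<close>

locale peeling =
  fixes X :: "nat set" and d :: z4 and bit_f step_f :: "nat \<Rightarrow> nat" and m n :: nat
  assumes bit_f: "x \<in> X \<Longrightarrow> bit_f x \<in> {0, 1}"
    and step_f: "x \<in> X \<Longrightarrow> step_f x \<in> X" "x \<in> X \<Longrightarrow> bit_f (step_f x) = 1 - bit_f x"
      "x \<in> X \<Longrightarrow> of_nat (step_f x) = of_nat x - d"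
begin

text \<open>Two accounts of the same peeled products: the one modulo 4 identifies the array with the
  residual, the one over GF(2) becomes the rank decomposition. Pivot rows and columns stay free of
  bits, which forces later peeled vectors to vanish at earlier pivots.\<close>

definition peeled :: "array \<Rightarrow> array \<Rightarrow> nat \<Rightarrow> array \<Rightarrow> array \<Rightarrow> bool" where
  "peeled A0 A k U W \<longleftrightarrow>
    (\<forall>a<m. \<forall>b<n. A a b \<in> X \<and>
      of_nat (A a b) = of_nat (A0 a b) - d * (\<Sum>t<k. of_nat (U t a * W t b)) \<and>
      (of_nat (bit_f (A a b)) :: bit) = of_nat (bit_f (A0 a b)) + (\<Sum>t<k. of_nat (U t a * W t b))) \<and>
    (\<forall>t<k. (\<forall>a<m. U t a \<in> {0, 1}) \<and> (\<forall>b<n. W t b \<in> {0, 1})) \<and>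
    (\<exists>p q. \<forall>t<k. p t < m \<and> q t < n \<and> U t (p t) = 1 \<and> W t (q t) = 1 \<and>
      (\<forall>s<k. t < s \<longrightarrow> U s (p t) = 0 \<and> W s (q t) = 0) \<and>
      (\<forall>b<n. bit_f (A (p t) b) = 0) \<and> (\<forall>a<m. bit_f (A a (q t)) = 0))"

lemma peeledD:
  assumes "peeled A0 A k U W"
  shows "a < m \<Longrightarrow> b < n \<Longrightarrow> A a b \<in> X"
    and "a < m \<Longrightarrow> b < n \<Longrightarrow>
      of_nat (A a b) = of_nat (A0 a b) - d * (\<Sum>t<k. of_nat (U t a * W t b))"
    and "t < k \<Longrightarrow> a < m \<Longrightarrow> U t a \<in> {0, 1}" and "t < k \<Longrightarrow> b < n \<Longrightarrow> W t b \<in> {0, 1}"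
  using assms by (simp_all only: peeled_def)


lemma peeled_init:
  assumes "\<And>a b. a < m \<Longrightarrow> b < n \<Longrightarrow> A a b \<in> X"
  shows "peeled A A 0 U W"
  using assms by (simp add: peeled_def)

text \<open>In the pivot row an entry is stepped exactly when its bit is 1, because the pivot itself
  has bit 1; so that row is cleared, and likewise the pivot column. A row or column without bits is
  never stepped.\<close>

lemma peeled_step:
  assumes P: "peeled A0 A k U W" and ij: "i < m" "j < n" "bit_f (A i j) \<noteq> 0"
    and UW: "\<And>t. t \<noteq> k \<Longrightarrow> U' t = U t" "\<And>t. t \<noteq> k \<Longrightarrow> W' t = W t"
    and U': "\<And>a. a < m \<Longrightarrow> U' k a = bit_f (A a j)"
    and W': "\<And>b. b < n \<Longrightarrow> W' k b = bit_f (A i b)"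
    and A': "\<And>a b. a < m \<Longrightarrow> b < n \<Longrightarrow> A' a b =
      (if 0 < bit_f (A a j) \<and> 0 < bit_f (A i b) then step_f (A a b) else A a b)"
  shows "peeled A0 A' (Suc k) U' W'"
    and "\<And>a. a < m \<Longrightarrow> (\<And>b. b < n \<Longrightarrow> bit_f (A a b) = 0) \<Longrightarrow> (\<And>b. b < n \<Longrightarrow> bit_f (A' a b) = 0)"
    and "\<And>b. b < n \<Longrightarrow> bit_f (A' i b) = 0"
proof -
  have X: "A a b \<in> X" if "a < m" "b < n" for a b using P that by (simp add: peeled_def)
  have b01: "bit_f (A a b) = 0 \<or> bit_f (A a b) = 1" if "a < m" "b < n" for a b
    using bit_f[OF X[OF that]] by simp
  have one: "bit_f (A i j) = 1" using b01[OF ij(1,2)] ij(3) by simp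
  have row_i: "bit_f (A' i b) = 0" if "b < n" for b
    using b01[OF ij(1) that] one step_f(2)[OF X[OF ij(1) that]] by (auto simp: A'[OF ij(1) that])
  have col_j: "bit_f (A' a j) = 0" if "a < m" for a
    using b01[OF that ij(2)] one step_f(2)[OF X[OF that ij(2)]] by (auto simp: A'[OF that ij(2)])
  have row: "bit_f (A' a b) = 0" if "a < m" "\<And>b. b < n \<Longrightarrow> bit_f (A a b) = 0" "b < n" for a b
    using that ij(2) by (simp add: A')
  have col: "bit_f (A' a b) = 0" if "b < n" "\<And>a. a < m \<Longrightarrow> bit_f (A a b) = 0" "a < m" for a b
    using that ij(1) by (simp add: A')
  show "\<And>a b. a < m \<Longrightarrow> (\<And>b. b < n \<Longrightarrow> bit_f (A a b) = 0) \<Longrightarrow> b < n \<Longrightarrow> bit_f (A' a b) = 0"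
    by (rule row)
  show "\<And>b. b < n \<Longrightarrow> bit_f (A' i b) = 0" by (rule row_i)
  obtain p q where pq: "\<And>t. t < k \<Longrightarrow> p t < m \<and> q t < n \<and> U t (p t) = 1 \<and> W t (q t) = 1 \<and>
      (\<forall>s<k. t < s \<longrightarrow> U s (p t) = 0 \<and> W s (q t) = 0) \<and>
      (\<forall>b<n. bit_f (A (p t) b) = 0) \<and> (\<forall>a<m. bit_f (A a (q t)) = 0)"
    using P unfolding peeled_def by blast
  show "peeled A0 A' (Suc k) U' W'"
    unfolding peeled_def
  proof (intro conjI allI impI exI)
    fix a b assume ab: "a < m" "b < n"
    show "A' a b \<in> X" using X step_f(1) ab by (simp add: A')
    \<comment> \<open>\<open>c\<close> is the new rank-one entry: the array entry changes by
      \<open>d * c\<close> modulo 4 and its bit by \<open>c\<close>.\<close>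
    define c where "c = bit_f (A a j) * bit_f (A i b)"
    have c: "c = 0 \<or> c = 1" and new: "U' k a * W' k b = c"
      using b01[OF ab(1) ij(2)] b01[OF ij(1) ab(2)] by (auto simp: U' W' ab c_def)
    have A'ab: "A' a b = (if c = 1 then step_f (A a b) else A a b)"
      using b01[OF ab(1) ij(2)] b01[OF ij(1) ab(2)] by (auto simp: A'[OF ab] c_def)
    have old: "U' t a * W' t b = U t a * W t b" if "t < k" for t using UW that by simp
    have "of_nat (A a b) = of_nat (A0 a b) - d * (\<Sum>t<k. of_nat (U t a * W t b))"
      using P ab unfolding peeled_def by blast
    moreover have "of_nat (A' a b) = of_nat (A a b) - d * of_nat c"
      using c step_f(3)[OF X[OF ab]] A'ab by auto
    moreover have "(\<Sum>t<Suc k. of_nat (U' t a * W' t b)) = (\<Sum>t<k. of_nat (U t a * W t b)) + (of_nat c :: z4)"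
      unfolding sum.lessThan_Suc new by (intro arg_cong2[where f = plus] sum.cong refl) (simp only: old lessThan_iff)
    ultimately show "of_nat (A' a b) = of_nat (A0 a b) - d * (\<Sum>t<Suc k. of_nat (U' t a * W' t b))"
      by (simp only: distrib_left diff_diff_eq)
    have "(of_nat (bit_f (A a b)) :: bit) = of_nat (bit_f (A0 a b)) + (\<Sum>t<k. of_nat (U t a * W t b))"
      using P ab unfolding peeled_def by blast
    moreover have "(of_nat (bit_f (A' a b)) :: bit) = of_nat (bit_f (A a b)) + of_nat c"
      using c step_f(2)[OF X[OF ab]] A'ab b01[OF ab] by auto
    moreover have "(\<Sum>t<Suc k. of_nat (U' t a * W' t b)) = (\<Sum>t<k. of_nat (U t a * W t b)) + (of_nat c :: bit)"
      unfolding sum.lessThan_Suc new by (intro arg_cong2[where f = plus] sum.cong refl) (simp only: old lessThan_iff)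
    ultimately show "(of_nat (bit_f (A' a b)) :: bit) = of_nat (bit_f (A0 a b)) + (\<Sum>t<Suc k. of_nat (U' t a * W' t b))"
      by (simp only: add.assoc)
  next
    fix t a assume "t < Suc k" "a < m"
    then show "U' t a \<in> {0, 1}"
      using P UW U' b01[OF _ ij(2)] by (cases "t = k") (auto simp: peeled_def)
  next
    fix t b assume "t < Suc k" "b < n"
    then show "W' t b \<in> {0, 1}"
      using P UW W' b01[OF ij(1)] by (cases "t = k") (auto simp: peeled_def)
  next
    let ?p = "p(k := i)" and ?q = "q(k := j)"
    fix t assume "t < Suc k"
    then have t: "t < k \<or> t = k" by auto
    show "?p t < m" "?q t < n" using t pq ij by auto
    show "U' t (?p t) = 1" "W' t (?q t) = 1" using t pq ij one by (auto simp: UW U' W')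
    show "bit_f (A' (?p t) b) = 0" if "b < n" for b using t row_i row pq that by auto
    show "bit_f (A' a (?q t)) = 0" if "a < m" for a using t col_j col pq that by auto
    fix s assume "s < Suc k" "t < s"
    then have ts: "t < k" "s < k \<or> s = k" by auto
    \<comment> \<open>For \<open>s = k\<close> the new vectors are read off column \<open>j\<close>
      and row \<open>i\<close> of \<open>A\<close>, whose cells in earlier pivot rows and columns
      carry no bit.\<close>
    show "U' s (?p t) = 0" "W' s (?q t) = 0"
      using ts \<open>t < s\<close> pq[OF ts(1)] ij by (auto simp: UW U' W')
  qed
qed

text \<open>Once no bits remain, the account over GF(2) says that the initial bit plus the sum is
  zero, which in characteristic 2 is the decomposition; the pivots make it triangular.\<close>

lemma peeled_rank_decomposition:
  assumes P: "peeled A0 A k U W" and zero: "\<And>a b. a < m \<Longrightarrow> b < n \<Longrightarrow> bit_f (A a b) = 0"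
    and B: "B \<in> carrier_mat m n" "\<And>a b. a < m \<Longrightarrow> b < n \<Longrightarrow> B $$ (a, b) = of_nat (bit_f (A0 a b))"
  shows "rank_decomposition m n B k (\<lambda>t. vec m (\<lambda>a. of_nat (U t a))) (\<lambda>t. vec n (\<lambda>b. of_nat (W t b)))"
proof -
  obtain p q where pq: "\<And>t. t < k \<Longrightarrow> p t < m \<and> q t < n \<and> U t (p t) = 1 \<and> W t (q t) = 1 \<and>
      (\<forall>s<k. t < s \<longrightarrow> U s (p t) = 0 \<and> W s (q t) = 0) \<and>
      (\<forall>b<n. bit_f (A (p t) b) = 0) \<and> (\<forall>a<m. bit_f (A a (q t)) = 0)"
    using P unfolding peeled_def by blast
  show ?thesis
  proof (rule triangular_rank_decomposition[OF B(1), where p = p and q = q])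
    fix a b assume ab: "a < m" "b < n"
    have "(of_nat (bit_f (A a b)) :: bit) = of_nat (bit_f (A0 a b)) + (\<Sum>t<k. of_nat (U t a * W t b))"
      using P ab unfolding peeled_def by blast
    then have "of_nat (bit_f (A0 a b)) = (\<Sum>t<k. of_nat (U t a * W t b) :: bit)"
      unfolding zero[OF ab] of_nat_0 bit_add_eq_0_iff .
    then show "B $$ (a, b) = (\<Sum>t<k. vec n (\<lambda>b. of_nat (W t b)) $ b * vec m (\<lambda>a. of_nat (U t a)) $ a)"
      using ab by (simp add: B(2) mult.commute)
  next
    fix t assume t: "t < k"
    then show "p t < m" "q t < n" using pq by blast+
    then show "vec m (\<lambda>a. of_nat (U t a) :: bit) $ p t = 1" "vec n (\<lambda>b. of_nat (W t b) :: bit) $ q t = 1"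
      using pq[OF t] by simp_all
  next
    fix s t assume "s < t" "t < k"
    then show "vec m (\<lambda>a. of_nat (U t a) :: bit) $ p s = 0" "vec n (\<lambda>b. of_nat (W t b) :: bit) $ q s = 0"
      using pq[of s] by simp_all
  qed simp_all
qed

end

section \<open>The program\<close>

definition runs :: "com \<Rightarrow> state \<Rightarrow> nat \<Rightarrow> (state \<Rightarrow> bool) \<Rightarrow> bool" where
  "runs c s T Q \<longleftrightarrow> (\<exists>t s'. exec c s t s' \<and> t \<le> T \<and> Q s')"

lemma runs_mono: "runs c s T Q \<Longrightarrow> T \<le> T' \<Longrightarrow> (\<And>s'. Q s' \<Longrightarrow> Q' s') \<Longrightarrow> runs c s T' Q'"
  unfolding runs_def using le_trans by blast

lemma runs_Skip: "Q s \<Longrightarrow> runs Skip s 1 Q"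
  unfolding runs_def by (intro exI[of _ 1] exI[of _ s]) (simp add: exec.Skip[simplified])

lemma runs_Assign: "Q ((fst s)(x := aval e s), snd s) \<Longrightarrow> runs (Assign x e) s 1 Q"
  unfolding runs_def using exec.Assign[of x e s] by fast

lemma runs_Store:
  "Q (update_cell s a (aval e s) (aval f s) (aval g s)) \<Longrightarrow> runs (Store a e f g) s 1 Q"
  unfolding runs_def using exec.Store[of a e f g s] by fast

lemma runs_Seq: "runs c s T (\<lambda>s'. runs d s' T' Q) \<Longrightarrow> runs (Seq c d) s (T + T') Q"
proof -
  assume "runs c s T (\<lambda>s'. runs d s' T' Q)"
  then obtain t s' t' s'' where "exec c s t s'" "t \<le> T" "exec d s' t' s''" "t' \<le> T'" "Q s''"
    unfolding runs_def by blast
  then show "runs (Seq c d) s (T + T') Q"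
    unfolding runs_def using exec.Seq[of c s t s' d t' s''] add_mono[of t T t' T'] by blast
qed

lemma runs_Cond:
  assumes "bval b s \<Longrightarrow> runs c s T Q" "\<not> bval b s \<Longrightarrow> runs d s T Q"
  shows "runs (Cond b c d) s (Suc T) Q"
proof (cases "bval b s")
  case True
  then obtain t s' where "exec c s t s'" "t \<le> T" "Q s'" using assms(1) unfolding runs_def by blast
  then show ?thesis
    unfolding runs_def using exec.CondTrue[of b s c t s' d] True by (intro exI[of _ "Suc t"] exI[of _ s']) simp
next
  case False
  then obtain t s' where "exec d s t s'" "t \<le> T" "Q s'" using assms(2) unfolding runs_def by blast
  then show ?thesis
    unfolding runs_def using exec.CondFalse[of b s d t s' c] False by (intro exI[of _ "Suc t"] exI[of _ s']) simp
qed

definition For :: "vname \<Rightarrow> aexp \<Rightarrow> com \<Rightarrow> com" where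
  "For x e c = Seq (Assign x (N 0)) (While (BLess (V x) e) (Seq c (Assign x (Plus (V x) (N 1)))))"

text \<open>The expression \<open>e\<close> is evaluated anew at each test, hence the premise that
  it keeps the value \<open>B\<close>. A round costs \<open>T + 2\<close> for test, body and
  increment; the final \<open>1\<close> is the failing test.\<close>

lemma runs_While_upto:
  assumes "\<And>k s. k < B \<Longrightarrow> I k s \<Longrightarrow> fst s x = k \<Longrightarrow>
      runs c s T (\<lambda>s'. fst s' x = k \<and> I (Suc k) ((fst s')(x := Suc k), snd s'))"
    and "\<And>k s. k \<le> B \<Longrightarrow> I k s \<Longrightarrow> aval e s = B"
    and "k \<le> B" "I k s" "fst s x = k"
  shows "runs (While (BLess (V x) e) (Seq c (Assign x (Plus (V x) (N 1))))) s
    ((B - k) * (T + 2) + 1) (\<lambda>s'. I B s' \<and> fst s' x = B)"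
  using assms(3-5)
proof (induction "B - k" arbitrary: k s)
  case 0
  then have "k = B" by simp
  then have "\<not> bval (BLess (V x) e) s" using 0 assms(2)[of B s] by simp
  then show ?case
    unfolding runs_def using exec.WhileFalse 0 \<open>k = B\<close> by (intro exI[of _ 1] exI[of _ s]) simp
next
  case (Suc l)
  let ?W = "While (BLess (V x) e) (Seq c (Assign x (Plus (V x) (N 1))))"
  have k: "k < B" using Suc.hyps(2) by simp
  then have b: "bval (BLess (V x) e) s" using Suc.prems assms(2)[of k s] by simp
  obtain t s' where c: "exec c s t s'" "t \<le> T" "fst s' x = k" "I (Suc k) ((fst s')(x := Suc k), snd s')"
    using assms(1)[OF k Suc.prems(2,3)] unfolding runs_def by blast
  have body: "exec (Seq c (Assign x (Plus (V x) (N 1)))) s (t + 1) ((fst s')(x := Suc k), snd s')"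
    using exec.Seq[OF c(1) exec.Assign[of x "Plus (V x) (N 1)" s']] c(3) by simp
  obtain t' s'' where w: "exec ?W ((fst s')(x := Suc k), snd s') t' s''"
    "t' \<le> (B - Suc k) * (T + 2) + 1" "I B s''" "fst s'' x = B"
  proof -
    have "runs ?W ((fst s')(x := Suc k), snd s') ((B - Suc k) * (T + 2) + 1) (\<lambda>s'. I B s' \<and> fst s' x = B)"
      by (rule Suc.hyps(1)) (use Suc.hyps(2) k c(4) in simp_all)
    then show ?thesis using that unfolding runs_def by blast
  qed
  have "exec ?W s (Suc (t + 1 + t')) s''" by (rule exec.WhileTrue[OF b body w(1)])
  moreover have "B - k = Suc (B - Suc k)" using k by simp
  then have "Suc (t + 1 + t') \<le> (B - k) * (T + 2) + 1" using w(2) c(2) by simp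
  ultimately show ?case unfolding runs_def using w by blast
qed

lemma runs_For:
  assumes "I 0 ((fst s)(x := 0), snd s)"
    and "\<And>k s. k \<le> B \<Longrightarrow> I k s \<Longrightarrow> aval e s = B"
    and "\<And>k s. k < B \<Longrightarrow> I k s \<Longrightarrow> fst s x = k \<Longrightarrow>
      runs c s T (\<lambda>s'. fst s' x = k \<and> I (Suc k) ((fst s')(x := Suc k), snd s'))"
    and "\<And>s'. I B s' \<Longrightarrow> Q s'"
  shows "runs (For x e c) s (B * (T + 2) + 2) Q"
proof -
  have "runs (While (BLess (V x) e) (Seq c (Assign x (Plus (V x) (N 1)))))
      ((fst s)(x := 0), snd s) (B * (T + 2) + 1) Q"
    by (rule runs_mono[OF runs_While_upto[where k = 0 and B = B and I = I and T = T]])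
      (use assms in auto)
  then have "runs (For x e c) s (1 + (B * (T + 2) + 1)) Q"
    unfolding For_def by (intro runs_Seq runs_Assign) simp
  then show ?thesis by (rule runs_mono) simp_all
qed

section \<open>Program and specification of a single pivot\<close>

definition unchanged :: "state \<Rightarrow> state \<Rightarrow> vname set \<Rightarrow> vname set \<Rightarrow> bool" where
  "unchanged s s' X Y \<longleftrightarrow> (\<forall>x. x \<notin> X \<longrightarrow> fst s' x = fst s x) \<and> (\<forall>a. a \<notin> Y \<longrightarrow> snd s' a = snd s a)"

text \<open>The program side of \<open>peeling\<close>: expressions that compute
  \<open>bit_f\<close> and \<open>step_f\<close>. The conditions on names rule out aliasing between
  outputs, dimensions, loop counters and \<open>M\<close>.\<close>

locale peeling_names =
  fixes kx U W :: vname and bit_e step_e :: "aexp \<Rightarrow> aexp" and bit_f step_f :: "nat \<Rightarrow> nat"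
  assumes names: "kx \<notin> {''m'', ''n'', ''i'', ''j'', ''a'', ''b''}" "U \<noteq> ''M''" "W \<noteq> ''M''" "U \<noteq> W"
    and aval_bit_e: "aval (bit_e e) s = bit_f (aval e s)"
    and aval_step_e: "aval (step_e e) s = step_f (aval e s)"
begin

definition copy_prog :: "vname \<Rightarrow> vname \<Rightarrow> aexp \<Rightarrow> com" where
  "copy_prog A d src = For ''a'' (V d) (Store A (V kx) (V ''a'') (bit_e src))"

lemma runs_copy_prog:
  assumes "d \<noteq> ''a''" "fst s d = D" "fst s kx = k"
    and src: "\<And>s'. unchanged s s' {''a''} {A} \<Longrightarrow> aval src s' = g (fst s' ''a'')"
  shows "runs (copy_prog A d src) s (D * 3 + 2) (\<lambda>s'. unchanged s s' {''a''} {A} \<and>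
    (\<forall>t. t \<noteq> k \<longrightarrow> snd s' A t = snd s A t) \<and> (\<forall>p<D. snd s' A k p = bit_f (g p)))"
proof -
  let ?I = "\<lambda>p s'. unchanged s s' {''a''} {A} \<and>
    (\<forall>t. t \<noteq> k \<longrightarrow> snd s' A t = snd s A t) \<and> (\<forall>q<p. snd s' A k q = bit_f (g q))"
  have "runs (copy_prog A d src) s (D * (1 + 2) + 2) (?I D)"
    unfolding copy_prog_def
  proof (rule runs_For[where I = ?I])
    show "?I 0 ((fst s)(''a'' := 0), snd s)" by (simp add: unchanged_def)
    show "aval (V d) s' = D" if "?I p s'" for p s'
      using that assms(1,2) by (auto simp: unchanged_def)
    fix p s' assume p: "?I p s'" "fst s' ''a'' = p"
    have "aval (bit_e src) s' = bit_f (g p)" using src p by (simp add: aval_bit_e)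
    moreover have "fst s' kx = k" using p(1) assms(3) names(1) by (simp add: unchanged_def)
    ultimately show "runs (Store A (V kx) (V ''a'') (bit_e src)) s' 1
        (\<lambda>s''. fst s'' ''a'' = p \<and> ?I (Suc p) ((fst s'')(''a'' := Suc p), snd s''))"
      by (intro runs_Store) (use p in \<open>auto simp: update_cell_def unchanged_def less_Suc_eq\<close>)
  qed
  then show ?thesis by (rule runs_mono) simp_all
qed

definition update_prog :: com where
  "update_prog = For ''a'' (V ''m'') (For ''b'' (V ''n'')
     (Cond (BAnd (BLess (N 0) (Cell U (V kx) (V ''a''))) (BLess (N 0) (Cell W (V kx) (V ''b''))))
       (Store ''M'' (V ''a'') (V ''b'') (step_e (Cell ''M'' (V ''a'') (V ''b'')))) Skip))"

lemma runs_update_prog: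
  assumes "fst s ''m'' = m" "fst s ''n'' = n" "fst s kx = k"
  shows "runs update_prog s (m * (4 * n + 4) + 2) (\<lambda>s'. unchanged s s' {''a'', ''b''} {''M''} \<and>
    (\<forall>a<m. \<forall>b<n. snd s' ''M'' a b = (if 0 < snd s U k a \<and> 0 < snd s W k b
       then step_f (snd s ''M'' a b) else snd s ''M'' a b)))"
proof -
  \<comment> \<open>\<open>P\<close> marks the cells already visited. All values on the right are
    those of the initial state, since each cell is visited once and the factors in \<open>U\<close>
    and \<open>W\<close> are not written.\<close>
  define upd where "upd s' P \<longleftrightarrow> unchanged s s' {''a'', ''b''} {''M''} \<and>
    (\<forall>a b. snd s' ''M'' a b = (if P a b \<and> 0 < snd s U k a \<and> 0 < snd s W k b
       then step_f (snd s ''M'' a b) else snd s ''M'' a b))" for s' and P :: "nat \<Rightarrow> nat \<Rightarrow> bool"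
  let ?I = "\<lambda>p s'. upd s' (\<lambda>a b. a < p \<and> b < n)"
  let ?J = "\<lambda>p q s'. fst s' ''a'' = p \<and> upd s' (\<lambda>a b. a < p \<and> b < n \<or> a = p \<and> b < q)"
  have "runs update_prog s (m * ((n * (Suc 1 + 2) + 2) + 2) + 2) (?I m)"
    unfolding update_prog_def
  proof (rule runs_For[where I = ?I])
    show "?I 0 ((fst s)(''a'' := 0), snd s)" by (simp add: upd_def unchanged_def)
    show "aval (V ''m'') s' = m" if "?I p s'" for p s'
      using that assms by (auto simp: upd_def unchanged_def)
    fix p s' assume p: "?I p s'" "fst s' ''a'' = p" "p < m"
    show "runs (For ''b'' (V ''n'')
       (Cond (BAnd (BLess (N 0) (Cell U (V kx) (V ''a''))) (BLess (N 0) (Cell W (V kx) (V ''b''))))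
       (Store ''M'' (V ''a'') (V ''b'') (step_e (Cell ''M'' (V ''a'') (V ''b'')))) Skip)) s' (n * (Suc 1 + 2) + 2)
        (\<lambda>s''. fst s'' ''a'' = p \<and> ?I (Suc p) ((fst s'')(''a'' := Suc p), snd s''))"
    proof (rule runs_For[where I = "?J p"])
      show "?J p 0 ((fst s')(''b'' := 0), snd s')" using p by (auto simp: upd_def unchanged_def)
      show "aval (V ''n'') s'' = n" if "?J p q s''" for q s''
        using that assms by (auto simp: upd_def unchanged_def)
      show "fst s'' ''a'' = p \<and> ?I (Suc p) ((fst s'')(''a'' := Suc p), snd s'')" if "?J p n s''" for s''
      proof -
        have "(\<lambda>a b. a < p \<and> b < n \<or> a = p \<and> b < n) = (\<lambda>a b. a < Suc p \<and> b < n)"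
          by (auto simp: fun_eq_iff less_Suc_eq)
        then show ?thesis using that by (simp add: upd_def unchanged_def)
      qed
      fix q s'' assume q: "?J p q s''" "fst s'' ''b'' = q" "q < n"
      \<comment> \<open>The cell about to be visited still holds its initial value.\<close>
      have cells: "fst s'' kx = k" "snd s'' U = snd s U" "snd s'' W = snd s W"
        "snd s'' ''M'' p q = snd s ''M'' p q"
        using q assms(3) names by (auto simp: upd_def unchanged_def)
      let ?P = "\<lambda>a b. a < p \<and> b < n \<or> a = p \<and> b < q"
      let ?P' = "\<lambda>a b. a < p \<and> b < n \<or> a = p \<and> b < Suc q"
      let ?c = "BAnd (BLess (N 0) (Cell U (V kx) (V ''a''))) (BLess (N 0) (Cell W (V kx) (V ''b'')))"
      have c: "bval ?c s'' \<longleftrightarrow> 0 < snd s U k p \<and> 0 < snd s W k q"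
        using q cells by simp
      have fr: "unchanged s s'' {''a'', ''b''} {''M''}"
        and M: "\<And>a b. snd s'' ''M'' a b = (if ?P a b \<and> 0 < snd s U k a \<and> 0 < snd s W k b
       then step_f (snd s ''M'' a b) else snd s ''M'' a b)"
        using q(1) unfolding upd_def by blast+
      have P': "?P' a b \<longleftrightarrow> ?P a b \<or> a = p \<and> b = q" for a b by auto
      show "runs (Cond ?c (Store ''M'' (V ''a'') (V ''b'') (step_e (Cell ''M'' (V ''a'') (V ''b'')))) Skip)
          s'' (Suc 1) (\<lambda>r. fst r ''b'' = q \<and> ?J p (Suc q) ((fst r)(''b'' := Suc q), snd r))"
      proof (intro runs_Cond runs_Store runs_Skip)
        let ?r = "update_cell s'' ''M'' (aval (V ''a'') s'') (aval (V ''b'') s'')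
          (aval (step_e (Cell ''M'' (V ''a'') (V ''b''))) s'')"
        assume "bval ?c s''"
        then have pq: "0 < snd s U k p" "0 < snd s W k q" using c by blast+
        have r: "?r = update_cell s'' ''M'' p q (step_f (snd s ''M'' p q))"
          using q cells(4) by (simp add: aval_step_e)
        have "snd ?r ''M'' a b = (if ?P' a b \<and> 0 < snd s U k a \<and> 0 < snd s W k b
            then step_f (snd s ''M'' a b) else snd s ''M'' a b)" for a b
          unfolding P' r using pq by (cases "a = p \<and> b = q") (auto simp: update_cell_def M)
        moreover have "unchanged s ((fst ?r)(''b'' := Suc q), snd ?r) {''a'', ''b''} {''M''}"
          using fr by (simp add: unchanged_def update_cell_def)
        ultimately have "upd ((fst ?r)(''b'' := Suc q), snd ?r) ?P'"
          unfolding upd_def by simp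
        moreover have "fst ?r ''b'' = q" "fst ?r ''a'' = p" using q by (simp_all add: update_cell_def)
        ultimately show "fst ?r ''b'' = q \<and> ?J p (Suc q) ((fst ?r)(''b'' := Suc q), snd ?r)" by simp
      next
        assume "\<not> bval ?c s''"
        then have pq: "\<not> (0 < snd s U k p \<and> 0 < snd s W k q)" using c by blast
        have "snd s'' ''M'' a b = (if ?P' a b \<and> 0 < snd s U k a \<and> 0 < snd s W k b
            then step_f (snd s ''M'' a b) else snd s ''M'' a b)" for a b
          unfolding P' M using pq by (cases "a = p \<and> b = q") auto
        moreover have "unchanged s ((fst s'')(''b'' := Suc q), snd s'') {''a'', ''b''} {''M''}"
          using fr by (simp add: unchanged_def)
        ultimately have "upd ((fst s'')(''b'' := Suc q), snd s'') ?P'"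
          unfolding upd_def by simp
        then show "fst s'' ''b'' = q \<and> ?J p (Suc q) ((fst s'')(''b'' := Suc q), snd s'')"
          using q by simp
      qed
    qed
  qed
  then show ?thesis by (rule runs_mono) (simp_all add: upd_def algebra_simps)
qed

text \<open>The bits of the pivot column and row are saved first: the update overwrites
  \<open>M\<close> in place and takes its factors from the saved copies.\<close>

definition pivot_prog :: com where
  "pivot_prog = Seq (copy_prog U ''m'' (Cell ''M'' (V ''a'') (V ''j'')))
     (Seq (copy_prog W ''n'' (Cell ''M'' (V ''i'') (V ''a'')))
     (Seq update_prog (Assign kx (Plus (V kx) (N 1)))))"

lemma runs_pivot_prog:
  assumes "fst s ''m'' = m" "fst s ''n'' = n" "fst s kx = k" "fst s ''i'' = i" "fst s ''j'' = j" "i < m" "j < n"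
  shows "runs pivot_prog s (7 * m + 3 * n + 4 * (m * n) + 7) (\<lambda>s'.
    unchanged s s' {''a'', ''b'', kx} {''M'', U, W} \<and> fst s' kx = Suc k \<and>
    (\<forall>t. t \<noteq> k \<longrightarrow> snd s' U t = snd s U t \<and> snd s' W t = snd s W t) \<and>
    (\<forall>a<m. snd s' U k a = bit_f (snd s ''M'' a j)) \<and>
    (\<forall>b<n. snd s' W k b = bit_f (snd s ''M'' i b)) \<and>
    (\<forall>a<m. \<forall>b<n. snd s' ''M'' a b =
      (if 0 < bit_f (snd s ''M'' a j) \<and> 0 < bit_f (snd s ''M'' i b)
       then step_f (snd s ''M'' a b) else snd s ''M'' a b)))"
    (is "runs _ _ _ ?Q")
proof -
  let ?update = "Seq update_prog (Assign kx (Plus (V kx) (N 1)))"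
  \<comment> \<open>The summands are the costs of the two copies, the update and the
    increment.\<close>
  have "runs pivot_prog s ((m * 3 + 2) + ((n * 3 + 2) + ((m * (4 * n + 4) + 2) + 1))) ?Q"
    unfolding pivot_prog_def
  proof (rule runs_Seq, rule runs_mono[OF runs_copy_prog[where g = "\<lambda>a. snd s ''M'' a j"] order_refl])
    show "''m'' \<noteq> ''a''" by simp
    show "fst s ''m'' = m" "fst s kx = k" by (fact assms)+
    show "aval (Cell ''M'' (V ''a'') (V ''j'')) s' = snd s ''M'' (fst s' ''a'') j"
      if "unchanged s s' {''a''} {U}" for s'
      using that names assms by (simp add: unchanged_def)
    fix s1 assume s1: "unchanged s s1 {''a''} {U} \<and> (\<forall>t. t \<noteq> k \<longrightarrow> snd s1 U t = snd s U t) \<and>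
      (\<forall>p<m. snd s1 U k p = bit_f (snd s ''M'' p j))"
    show "runs (Seq (copy_prog W ''n'' (Cell ''M'' (V ''i'') (V ''a''))) ?update) s1
        ((n * 3 + 2) + ((m * (4 * n + 4) + 2) + 1)) ?Q"
    proof (rule runs_Seq, rule runs_mono[OF runs_copy_prog[where g = "\<lambda>b. snd s ''M'' i b"] order_refl])
      show "''n'' \<noteq> ''a''" by simp
      show "fst s1 ''n'' = n" "fst s1 kx = k" using s1 names assms by (auto simp: unchanged_def)
      show "aval (Cell ''M'' (V ''i'') (V ''a'')) s' = snd s ''M'' i (fst s' ''a'')"
        if "unchanged s1 s' {''a''} {W}" for s'
        using that s1 names assms by (simp add: unchanged_def)
      fix s2 assume s2: "unchanged s1 s2 {''a''} {W} \<and> (\<forall>t. t \<noteq> k \<longrightarrow> snd s2 W t = snd s1 W t) \<and>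
        (\<forall>p<n. snd s2 W k p = bit_f (snd s ''M'' i p))"
      show "runs ?update s2 ((m * (4 * n + 4) + 2) + 1) ?Q"
      proof (rule runs_Seq, rule runs_mono[OF runs_update_prog order_refl])
        show "fst s2 ''m'' = m" "fst s2 ''n'' = n" "fst s2 kx = k"
          using s1 s2 names assms by (auto simp: unchanged_def)
        fix s3 assume s3: "unchanged s2 s3 {''a'', ''b''} {''M''} \<and>
          (\<forall>a<m. \<forall>b<n. snd s3 ''M'' a b = (if 0 < snd s2 U k a \<and> 0 < snd s2 W k b
           then step_f (snd s2 ''M'' a b) else snd s2 ''M'' a b))"
        have U: "snd s2 U = snd s1 U" and W: "snd s1 W = snd s W"
          and M: "snd s2 ''M'' = snd s ''M''" and UW: "snd s3 U = snd s2 U" "snd s3 W = snd s2 W"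
          using s1 s2 s3 names by (auto simp: unchanged_def)
        have "fst s3 kx = k" using s1 s2 s3 names assms by (auto simp: unchanged_def)
        moreover have "unchanged s s3 {''a'', ''b'', kx} {''M'', U, W}"
          using s1 s2 s3 by (auto simp: unchanged_def)
        ultimately show "runs (Assign kx (Plus (V kx) (N 1))) s3 1 ?Q"
          by (intro runs_Assign) (use s1 s2 s3 U W M UW in \<open>auto simp: unchanged_def\<close>)
      qed
    qed
  qed
  then show ?thesis by (rule runs_mono) (simp_all add: algebra_simps)
qed

end

section \<open>A full stage: scanning for pivots\<close>

locale peeling_program =
  peeling_names kx U W bit_e step_e bit_f step_f + peeling X d bit_f step_f m n
  for kx U W :: vname and bit_e step_e bit_f step_f X d m n
begin

text \<open>A single row-major pass suffices: a pivot clears its whole row, and rows already free of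
  bits stay so under later pivots.\<close>

definition stage_prog :: com where
  "stage_prog = For ''i'' (V ''m'') (For ''j'' (V ''n'')
     (Cond (BLess (N 0) (bit_e (Cell ''M'' (V ''i'') (V ''j'')))) pivot_prog Skip))"

definition stage_inv :: "state \<Rightarrow> nat \<Rightarrow> state \<Rightarrow> bool" where
  "stage_inv s r s' \<longleftrightarrow> unchanged s s' {''i'', ''j'', ''a'', ''b'', kx} {''M'', U, W} \<and>
    peeled (snd s ''M'') (snd s' ''M'') (fst s' kx) (snd s' U) (snd s' W) \<and>
    (\<forall>a<r. a < m \<longrightarrow> (\<forall>b<n. bit_f (snd s' ''M'' a b) = 0))"

definition row_inv :: "state \<Rightarrow> nat \<Rightarrow> nat \<Rightarrow> state \<Rightarrow> bool" where
  "row_inv s i j s' \<longleftrightarrow> stage_inv s i s' \<and> fst s' ''i'' = i \<and>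
    (\<forall>b<j. b < n \<longrightarrow> bit_f (snd s' ''M'' i b) = 0)"

lemma stage_inv_counter:
  assumes "x \<in> {''i'', ''j''}"
  shows "stage_inv s r ((fst s')(x := y), A) \<longleftrightarrow> stage_inv s r (fst s', A)"
  using assms names(1) by (auto simp: stage_inv_def unchanged_def)

lemma names_sym: "''m'' \<noteq> kx" "''n'' \<noteq> kx" "''i'' \<noteq> kx" "''j'' \<noteq> kx"
  using names(1) by auto

lemma stage_inv_dims:
  assumes "stage_inv s r s'"
  shows "fst s' ''m'' = fst s ''m''" "fst s' ''n'' = fst s ''n''"
  using assms by (simp_all add: stage_inv_def unchanged_def names_sym)

lemma runs_pivot_step:
  assumes s: "fst s ''m'' = m" "fst s ''n'' = n" and ij: "i < m" "j < n"
    and inv: "row_inv s i j s'" "fst s' ''j'' = j"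
  shows "runs (Cond (BLess (N 0) (bit_e (Cell ''M'' (V ''i'') (V ''j'')))) pivot_prog Skip) s'
    (Suc (7 * m + 3 * n + 4 * (m * n) + 7))
    (\<lambda>s''. fst s'' ''j'' = j \<and> row_inv s i (Suc j) ((fst s'')(''j'' := Suc j), snd s''))"
proof (rule runs_Cond)
  have st: "stage_inv s i s'" and i: "fst s' ''i'' = i"
    and z: "\<And>b. b < j \<Longrightarrow> b < n \<Longrightarrow> bit_f (snd s' ''M'' i b) = 0"
    using inv(1) by (auto simp: row_inv_def)
  let ?M = "snd s' ''M''"
  {
    assume "\<not> bval (BLess (N 0) (bit_e (Cell ''M'' (V ''i'') (V ''j'')))) s'"
    then have "bit_f (?M i j) = 0" using i inv(2) by (simp add: aval_bit_e)
    then have "row_inv s i (Suc j) ((fst s')(''j'' := Suc j), snd s')"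
      using st i z by (simp add: row_inv_def stage_inv_counter less_Suc_eq)
    then show "runs Skip s' (7 * m + 3 * n + 4 * (m * n) + 7)
        (\<lambda>s''. fst s'' ''j'' = j \<and> row_inv s i (Suc j) ((fst s'')(''j'' := Suc j), snd s''))"
      using inv(2) by (intro runs_mono[OF runs_Skip[of "\<lambda>r. r = s'"]]) auto
  }
  assume "bval (BLess (N 0) (bit_e (Cell ''M'' (V ''i'') (V ''j'')))) s'"
  then have nz: "bit_f (?M i j) \<noteq> 0" using i inv(2) by (simp add: aval_bit_e)
  show "runs pivot_prog s' (7 * m + 3 * n + 4 * (m * n) + 7)
      (\<lambda>s''. fst s'' ''j'' = j \<and> row_inv s i (Suc j) ((fst s'')(''j'' := Suc j), snd s''))"
  proof (rule runs_mono[OF runs_pivot_prog[OF _ _ refl i inv(2) ij] order_refl], goal_cases)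
    case 1 then show ?case using stage_inv_dims[OF st] s by simp
  next
    case 2 then show ?case using stage_inv_dims[OF st] s by simp
  next
    case (3 s'')
    let ?k = "fst s' kx" and ?A = "snd s'' ''M''"
    have un: "unchanged s' s'' {''a'', ''b'', kx} {''M'', U, W}" and k: "fst s'' kx = Suc ?k"
      and UW: "\<And>t. t \<noteq> ?k \<Longrightarrow> snd s'' U t = snd s' U t" "\<And>t. t \<noteq> ?k \<Longrightarrow> snd s'' W t = snd s' W t"
      and U': "\<And>a. a < m \<Longrightarrow> snd s'' U ?k a = bit_f (?M a j)"
      and W': "\<And>b. b < n \<Longrightarrow> snd s'' W ?k b = bit_f (?M i b)"
      and A': "\<And>a b. a < m \<Longrightarrow> b < n \<Longrightarrow> ?A a b =
        (if 0 < bit_f (?M a j) \<and> 0 < bit_f (?M i b) then step_f (?M a b) else ?M a b)"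
      using 3 by simp_all
    have P: "peeled (snd s ''M'') ?M ?k (snd s' U) (snd s' W)" using st by (simp add: stage_inv_def)
    note step = peeled_step[OF P ij nz UW U' W' A']
    have "unchanged s s'' {''i'', ''j'', ''a'', ''b'', kx} {''M'', U, W}"
      using st un by (auto simp: stage_inv_def unchanged_def)
    moreover have "\<forall>a<i. a < m \<longrightarrow> (\<forall>b<n. bit_f (?A a b) = 0)"
      using step(2) st by (simp add: stage_inv_def)
    ultimately have "stage_inv s i s''"
      using step(1) by (simp add: stage_inv_def k)
    moreover have "fst s'' ''i'' = i" "fst s'' ''j'' = j"
      using un i inv(2) by (simp_all add: unchanged_def names_sym)
    \<comment> \<open>The pivot clears the whole row \<open>i\<close>, in particular the cells up to
      column \<open>j\<close>.\<close>
    ultimately show ?case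
      using step(3) by (simp add: row_inv_def stage_inv_counter)
  qed
qed

definition stage_time :: nat where
  "stage_time = m * ((n * (Suc (7 * m + 3 * n + 4 * (m * n) + 7) + 2) + 2) + 2) + 2"

text \<open>For positive dimensions \<open>m\<close> and \<open>n\<close> are at most
  \<open>m * n\<close>, which turns the cost into a polynomial in the number of entries.\<close>

lemma stage_time_le:
  assumes "1 \<le> m" "1 \<le> n"
  shows "stage_time \<le> 2 + 14 * (m * n) + 14 * (m * n) * (m * n)"
proof -
  have N: "m \<le> m * n" "n \<le> m * n" using assms by simp_all
  have "stage_time = (m * n) * (7 * m + 3 * n + 4 * (m * n)) + 10 * (m * n) + 4 * m + 2"
    by (simp add: stage_time_def algebra_simps)
  also have "\<dots> \<le> (m * n) * (7 * (m * n) + 3 * (m * n) + 4 * (m * n)) + 10 * (m * n) + 4 * (m * n) + 2"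
    by (intro add_mono mult_le_mono N order_refl)
  finally show ?thesis by (simp add: algebra_simps)
qed

lemma runs_stage_prog:
  assumes s: "fst s ''m'' = m" "fst s ''n'' = n" "fst s kx = 0"
    and X: "\<And>a b. a < m \<Longrightarrow> b < n \<Longrightarrow> snd s ''M'' a b \<in> X"
  shows "runs stage_prog s stage_time (\<lambda>s'.
    unchanged s s' {''i'', ''j'', ''a'', ''b'', kx} {''M'', U, W} \<and>
    peeled (snd s ''M'') (snd s' ''M'') (fst s' kx) (snd s' U) (snd s' W) \<and>
    (\<forall>a<m. \<forall>b<n. bit_f (snd s' ''M'' a b) = 0))"
  unfolding stage_prog_def stage_time_def
proof (rule runs_For[where I = "stage_inv s"])
  have "stage_inv s 0 s"
    using peeled_init[OF X] s(3) by (simp add: stage_inv_def unchanged_def)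
  then show "stage_inv s 0 ((fst s)(''i'' := 0), snd s)" by (simp add: stage_inv_counter)
  show "aval (V ''m'') s' = m" if "stage_inv s r s'" for r s'
    using stage_inv_dims[OF that] s by simp
  fix i s' assume i: "i < m" "stage_inv s i s'" "fst s' ''i'' = i"
  show "runs (For ''j'' (V ''n'') (Cond (BLess (N 0) (bit_e (Cell ''M'' (V ''i'') (V ''j'')))) pivot_prog Skip)) s'
      (n * (Suc (7 * m + 3 * n + 4 * (m * n) + 7) + 2) + 2)
      (\<lambda>s''. fst s'' ''i'' = i \<and> stage_inv s (Suc i) ((fst s'')(''i'' := Suc i), snd s''))"
  proof (rule runs_For[where I = "row_inv s i"])
    show "row_inv s i 0 ((fst s')(''j'' := 0), snd s')"
      using i by (simp add: row_inv_def stage_inv_counter)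
    show "aval (V ''n'') s'' = n" if "row_inv s i j s''" for j s''
      using that stage_inv_dims[of s i s''] s by (simp add: row_inv_def)
    show "fst s'' ''i'' = i \<and> stage_inv s (Suc i) ((fst s'')(''i'' := Suc i), snd s'')"
      if "row_inv s i n s''" for s''
      using that by (auto simp: row_inv_def stage_inv_counter) (auto simp: stage_inv_def less_Suc_eq)
  qed (rule runs_pivot_step[OF s(1,2) i(1)])
next
  fix s' assume "stage_inv s m s'"
  then show "unchanged s s' {''i'', ''j'', ''a'', ''b'', kx} {''M'', U, W} \<and>
    peeled (snd s ''M'') (snd s' ''M'') (fst s' kx) (snd s' U) (snd s' W) \<and>
    (\<forall>a<m. \<forall>b<n. bit_f (snd s' ''M'' a b) = 0)"
    by (simp add: stage_inv_def)
qed

end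

text \<open>
  The expression language has no conditionals, so the parity and the cyclic predecessor of a
  value in \<open>{0,1,2,3}\<close> are expressed by truncated subtraction.
\<close>

definition parity_e :: "aexp \<Rightarrow> aexp" where
  "parity_e e = Plus (Minus e (Plus (Minus e (N 1)) (Minus e (N 1)))) (Minus e (N 2))"

definition pred_mod4_e :: "aexp \<Rightarrow> aexp" where
  "pred_mod4_e e = Plus (Minus e (N 1)) (Plus (Minus (N 1) e) (Plus (Minus (N 1) e) (Minus (N 1) e)))"

definition parity :: "nat \<Rightarrow> nat" where
  "parity x = (x - ((x - 1) + (x - 1))) + (x - 2)"

definition pred_mod4 :: "nat \<Rightarrow> nat" where
  "pred_mod4 x = (x - 1) + ((1 - x) + ((1 - x) + (1 - x)))"

section \<open>The two stages as instances, and their composition\<close>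

interpretation stage1: peeling_program "''k1''" "''U1''" "''V1''" parity_e pred_mod4_e parity pred_mod4 "{0, 1, 2, 3}" 1 m n
  for m n
  by unfold_locales (auto simp: parity_e_def pred_mod4_e_def parity_def pred_mod4_def)

text \<open>On \<open>{0, 2}\<close> the truncated \<open>x - 1\<close> is half the entry, and
  \<open>2 - x\<close> exchanges the two values, which is subtraction of 2 modulo 4.\<close>

interpretation stage2: peeling_program "''k2''" "''U2''" "''V2''" "\<lambda>e. Minus e (N 1)" "\<lambda>e. Minus (N 2) e"
  "\<lambda>x. x - 1" "\<lambda>x. 2 - x" "{0, 2}" 2 m n
  for m n
  by unfold_locales auto

lemma z4_rep_range: "z4_rep x \<in> {0, 1, 2, 3}"
  using z4_exhaust[of x] by auto

lemma of_nat_z4_rep: "of_nat (z4_rep x) = x"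
  using z4_exhaust[of x] by (elim disjE) simp_all

lemma of_nat_parity_z4_rep: "of_nat (parity (z4_rep x)) = z4_mod2 x"
  using z4_exhaust[of x] by (elim disjE) (simp_all add: parity_def)

lemma of_nat_eq_bit_z4: "x \<in> {0, 1} \<Longrightarrow> of_nat x = bit_z4 (of_nat x)"
  by auto

text \<open>Stage 1 peels modulo 4, so it leaves the residual in \<open>M\<close>, ready as input
  for stage 2.\<close>

definition two_stage_prog :: com where
  "two_stage_prog = Seq stage1.stage_prog stage2.stage_prog"

lemma runs_two_stage_prog:
  assumes M: "M \<in> carrier_mat m n"
  shows "runs two_stage_prog (input_state m n M) (stage1.stage_time m n + stage2.stage_time m n)
    (\<lambda>s. \<exists>k1 u1 v1 k2 u2 v2. stage1 m n M k1 u1 v1 \<and> stage2 m n M k1 u1 v1 k2 u2 v2 \<and>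
      holds_output s m n k1 u1 v1 k2 u2 v2)"
    (is "runs _ ?s _ ?Q")
  unfolding two_stage_prog_def
proof (rule runs_Seq, rule runs_mono[OF stage1.runs_stage_prog order_refl])
  show "fst ?s ''m'' = m" "fst ?s ''n'' = n" "fst ?s ''k1'' = 0"
    by (simp_all add: input_state_def)
  have A0: "snd ?s ''M'' a b = z4_rep (M $$ (a, b))" if "a < m" "b < n" for a b
    using that by (simp add: input_state_def)
  show "snd ?s ''M'' a b \<in> {0, 1, 2, 3}" if "a < m" "b < n" for a b
    unfolding A0[OF that] by (rule z4_rep_range)
  fix s1 :: state
  let ?A1 = "snd s1 ''M''" and ?k1 = "fst s1 ''k1''"
  let ?u1 = "\<lambda>t. vec m (\<lambda>a. of_nat (snd s1 ''U1'' t a))" and ?v1 = "\<lambda>t. vec n (\<lambda>b. of_nat (snd s1 ''V1'' t b))"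
  assume s1: "unchanged ?s s1 {''i'', ''j'', ''a'', ''b'', ''k1''} {''M'', ''U1'', ''V1''} \<and>
    stage1.peeled m n (snd ?s ''M'') ?A1 ?k1 (snd s1 ''U1'') (snd s1 ''V1'') \<and>
    (\<forall>a<m. \<forall>b<n. parity (?A1 a b) = 0)"
  then have P1: "stage1.peeled m n (snd ?s ''M'') ?A1 ?k1 (snd s1 ''U1'') (snd s1 ''V1'')"
    and z1: "\<And>a b. a < m \<Longrightarrow> b < n \<Longrightarrow> parity (?A1 a b) = 0" by simp_all
  have S1: "stage1 m n M ?k1 ?u1 ?v1"
    unfolding stage1_def
    by (rule stage1.peeled_rank_decomposition[OF P1 z1])
      (use M in \<open>auto simp: mat_mod2_index A0 of_nat_parity_z4_rep mat_mod2_def z4_mod2_def[symmetric]\<close>)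
  have U1: "snd s1 ''U1'' t a \<in> {0, 1}" if "t < ?k1" "a < m" for t a
    by (rule stage1.peeledD(3)[OF P1 that])
  have V1: "snd s1 ''V1'' t b \<in> {0, 1}" if "t < ?k1" "b < n" for t b
    by (rule stage1.peeledD(4)[OF P1 that])
  have A1: "?A1 a b \<in> {0, 2}" if "a < m" "b < n" for a b
  proof -
    have "?A1 a b \<in> {0, 1, 2, 3}" by (rule stage1.peeledD(1)[OF P1 that])
    then show ?thesis using z1[OF that] by (auto simp: parity_def)
  qed
  \<comment> \<open>With \<open>d = 1\<close> the account modulo 4 is the definition of the
    residual; peeled cells are 0 or 1, so they agree with the lifts of their bits.\<close>
  have res: "residual m n M ?k1 ?u1 ?v1 $$ (a, b) = of_nat (?A1 a b)" if ab: "a < m" "b < n" for a b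
  proof -
    have "(of_nat (?A1 a b) :: z4) = of_nat (snd ?s ''M'' a b)
        - 1 * (\<Sum>t<?k1. of_nat (snd s1 ''U1'' t a * snd s1 ''V1'' t b))"
      by (rule stage1.peeledD(2)[OF P1 ab])
    also have "(\<Sum>t<?k1. of_nat (snd s1 ''U1'' t a * snd s1 ''V1'' t b))
        = (\<Sum>t<?k1. bit_z4 (?u1 t $ a) * bit_z4 (?v1 t $ b))"
    proof (rule sum.cong[OF refl])
      fix t assume "t \<in> {..<?k1}"
      then have "t < ?k1" by simp
      from U1[OF this ab(1)] V1[OF this ab(2)] show "of_nat (snd s1 ''U1'' t a * snd s1 ''V1'' t b)
          = bit_z4 (?u1 t $ a) * bit_z4 (?v1 t $ b)"
        using ab of_nat_eq_bit_z4 by simp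
    qed
    finally show ?thesis
      unfolding residual_index[OF M S1 ab] A0[OF ab] of_nat_z4_rep by simp
  qed
  show "runs stage2.stage_prog s1 (stage2.stage_time m n) ?Q"
  proof (rule runs_mono[OF stage2.runs_stage_prog order_refl])
    show "fst s1 ''m'' = m" "fst s1 ''n'' = n" "fst s1 ''k2'' = 0"
      using s1 by (simp_all add: unchanged_def input_state_def)
    show "?A1 a b \<in> {0, 2}" if "a < m" "b < n" for a b by (rule A1[OF that])
    fix s2 :: state
    let ?A2 = "snd s2 ''M''" and ?k2 = "fst s2 ''k2''"
    let ?u2 = "\<lambda>t. vec m (\<lambda>a. of_nat (snd s2 ''U2'' t a))" and ?v2 = "\<lambda>t. vec n (\<lambda>b. of_nat (snd s2 ''V2'' t b))"
    assume s2: "unchanged s1 s2 {''i'', ''j'', ''a'', ''b'', ''k2''} {''M'', ''U2'', ''V2''} \<and>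
      stage2.peeled m n ?A1 ?A2 ?k2 (snd s2 ''U2'') (snd s2 ''V2'') \<and>
      (\<forall>a<m. \<forall>b<n. ?A2 a b - 1 = 0)"
    then have P2: "stage2.peeled m n ?A1 ?A2 ?k2 (snd s2 ''U2'') (snd s2 ''V2'')"
      and z2: "\<And>a b. a < m \<Longrightarrow> b < n \<Longrightarrow> ?A2 a b - 1 = 0" by simp_all
    have S2: "stage2 m n M ?k1 ?u1 ?v1 ?k2 ?u2 ?v2"
      unfolding stage2_def
    proof (rule stage2.peeled_rank_decomposition[OF P2 z2])
      show "mat_half (residual m n M ?k1 ?u1 ?v1) \<in> carrier_mat m n"
        using residual_carrier[OF M S1] by (simp add: mat_half_def)
      \<comment> \<open>The bit that stage 2 reads is the halved residual entry.\<close>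
      show "mat_half (residual m n M ?k1 ?u1 ?v1) $$ (a, b) = of_nat (?A1 a b - 1)"
        if "a < m" "b < n" for a b
        using A1[OF that] residual_carrier[OF M S1] res[OF that] that by (auto simp: mat_half_def)
    qed
    have U2: "snd s2 ''U2'' t a \<in> {0, 1}" if "t < ?k2" "a < m" for t a
      by (rule stage2.peeledD(3)[OF P2 that])
    have V2: "snd s2 ''V2'' t b \<in> {0, 1}" if "t < ?k2" "b < n" for t b
      by (rule stage2.peeledD(4)[OF P2 that])
    \<comment> \<open>Stage 2 writes under other names, so the output of stage 1 survives to the
      final state.\<close>
    have keep: "fst s2 ''k1'' = ?k1" "snd s2 ''U1'' = snd s1 ''U1''" "snd s2 ''V1'' = snd s1 ''V1''"
      using s2 by (simp_all add: unchanged_def)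
    have bit: "x = of_bit (of_nat x)" if "x \<in> {0, 1}" for x :: nat
      using that by auto
    have "holds_output s2 m n ?k1 ?u1 ?v1 ?k2 ?u2 ?v2"
      unfolding holds_output_def holds_vecs_def keep
      using bit[OF U1] bit[OF V1] bit[OF U2] bit[OF V2] by simp
    then show "?Q s2" using S1 S2 by blast
  qed
qed

text \<open>The running time concerns one fixed program, whereas validity and the bound hold for
  every choice of rank decompositions in the two stages, not only the computed ones.\<close>

theorem mainTheorem2:
  shows "(\<exists>(c :: com) (p :: nat poly). \<forall>m n M.
            1 \<le> m \<longrightarrow> 1 \<le> n \<longrightarrow> M \<in> carrier_mat m n \<longrightarrow>
            (\<exists>k1 u1 v1 k2 u2 v2 t s.
               exec c (input_state m n M) t s \<and> t \<le> poly p (m * n) \<and>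
               stage1 m n M k1 u1 v1 \<and> stage2 m n M k1 u1 v1 k2 u2 v2 \<and>
               holds_output s m n k1 u1 v1 k2 u2 v2)) \<and>
         (\<forall>m n M k1 u1 v1.
            1 \<le> m \<longrightarrow> 1 \<le> n \<longrightarrow> M \<in> carrier_mat m n \<longrightarrow> stage1 m n M k1 u1 v1 \<longrightarrow>
            (\<forall>i<m. \<forall>j<n. residual m n M k1 u1 v1 $$ (i, j) \<in> {0, 2}) \<and>
            (\<forall>k2 u2 v2. stage2 m n M k1 u1 v1 k2 u2 v2 \<longrightarrow>
               M = mat_sum m n k1 (\<lambda>t. lift_outer (u1 t) (v1 t)) +
                   mat_sum m n k2 (\<lambda>t. 2 \<cdot>\<^sub>m lift_outer (u2 t) (v2 t)) \<and>
               k1 + k2 \<le> 3 * r4 m n M))"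
proof (intro conjI)
  show "\<exists>(c :: com) (p :: nat poly). \<forall>m n M.
            1 \<le> m \<longrightarrow> 1 \<le> n \<longrightarrow> M \<in> carrier_mat m n \<longrightarrow>
            (\<exists>k1 u1 v1 k2 u2 v2 t s.
               exec c (input_state m n M) t s \<and> t \<le> poly p (m * n) \<and>
               stage1 m n M k1 u1 v1 \<and> stage2 m n M k1 u1 v1 k2 u2 v2 \<and>
               holds_output s m n k1 u1 v1 k2 u2 v2)"
  \<comment> \<open>The polynomial is twice the bound of a single stage:
    \<open>2 * (2 + 14 * N + 14 * N * N)\<close> with \<open>N = m * n\<close>.\<close>
  proof (intro exI[of _ two_stage_prog] exI[of _ "[:4, 28, 28:] :: nat poly"] allI impI)
    fix m n :: nat and M :: "z4 mat"
    assume mn: "1 \<le> m" "1 \<le> n" and M: "M \<in> carrier_mat m n"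
    obtain t s where t: "exec two_stage_prog (input_state m n M) t s"
      "t \<le> stage1.stage_time m n + stage2.stage_time m n"
      and out: "\<exists>k1 u1 v1 k2 u2 v2. stage1 m n M k1 u1 v1 \<and> stage2 m n M k1 u1 v1 k2 u2 v2 \<and>
        holds_output s m n k1 u1 v1 k2 u2 v2"
      using runs_two_stage_prog[OF M] unfolding runs_def by blast
    have "t \<le> 2 * (2 + 14 * (m * n) + 14 * (m * n) * (m * n))"
      unfolding mult_2
      by (rule order_trans[OF t(2) add_mono[OF stage1.stage_time_le[OF mn] stage2.stage_time_le[OF mn]]])
    also have "\<dots> = poly [:4, 28, 28:] (m * n)" by (simp add: algebra_simps)
    finally show "\<exists>k1 u1 v1 k2 u2 v2 t s.
               exec two_stage_prog (input_state m n M) t s \<and> t \<le> poly [:4, 28, 28:] (m * n) \<and>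
               stage1 m n M k1 u1 v1 \<and> stage2 m n M k1 u1 v1 k2 u2 v2 \<and>
               holds_output s m n k1 u1 v1 k2 u2 v2"
      using t(1) out by blast
  qed
next
  show "\<forall>m n M k1 u1 v1.
            1 \<le> m \<longrightarrow> 1 \<le> n \<longrightarrow> M \<in> carrier_mat m n \<longrightarrow> stage1 m n M k1 u1 v1 \<longrightarrow>
            (\<forall>i<m. \<forall>j<n. residual m n M k1 u1 v1 $$ (i, j) \<in> {0, 2}) \<and>
            (\<forall>k2 u2 v2. stage2 m n M k1 u1 v1 k2 u2 v2 \<longrightarrow>
               M = mat_sum m n k1 (\<lambda>t. lift_outer (u1 t) (v1 t)) +
                   mat_sum m n k2 (\<lambda>t. 2 \<cdot>\<^sub>m lift_outer (u2 t) (v2 t)) \<and>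
               k1 + k2 \<le> 3 * r4 m n M)"
  proof (intro allI impI conjI)
    fix m n M k1 u1 v1
    assume M: "M \<in> carrier_mat m n" and S1: "stage1 m n M k1 u1 v1"
    show "residual m n M k1 u1 v1 $$ (i, j) \<in> {0, 2}" if "i < m" "j < n" for i j
      using residual_mod2[OF M S1 that] by (simp only: z4_mod2_eq_0_iff)
    fix k2 u2 v2
    assume S2: "stage2 m n M k1 u1 v1 k2 u2 v2"
    show "M = mat_sum m n k1 (\<lambda>t. lift_outer (u1 t) (v1 t)) +
        mat_sum m n k2 (\<lambda>t. 2 \<cdot>\<^sub>m lift_outer (u2 t) (v2 t))"
      by (rule two_stage_decomposition[OF M S1 S2])
    show "k1 + k2 \<le> 3 * r4 m n M" by (rule two_stage_ranks_le_r4[OF M S1 S2])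
  qed
qed

end
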